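(* Let $f:\Omega\to V$ be a biholomorphism between domains of finite volume in $\mathbb{C}^n$, and assume that $V$ is a QDP. Then $f$ is a Bergman coordinate of $\Omega$.
   Context: A domain is a nonempty connected open set. For a domain $\Omega\subset\mathbb{C}^n$ ($n\ge1$), $H^2(\Omega)$ is the Bergman space of holomorphic functions on $\Omega$ square-integrable with respect to Lebesgue measure, and $K(z,w)$ is its Bergman kernel: holomorphic in $z$, antiholomorphic in $w$, with $\int_\Omega f(w)K(z,w)\,dV(w)=f(z)$ for all $f\in H^2(\Omega)$. The Bergman span of $\Omega$ is the complex linear span of the functions $z\mapsto\frac{\partial^\alpha}{\partial\bar w^\alpha}K(z,w)|_{w=w_0}$, where $\alpha$ ranges over multi-indices and $w_0$ ranges over $\Omega$. A domain of finite volume is a quadrature domain (for $H^2$ functions) if the constant function $1$ is in its Bergman span. A QDP is a quadrature domain such that every holomorphic polynomial (restricted to the domain) is in its Bergman span. A (global) Bergman coordinate of $\Omega$ is a biholomorphic mapping defined on $\Omega$ (onto its image in $\mathbb{C}^n$), each of whose component functions is a quotient of elements of the Bergman span of $\Omega$ (with denominator not identically zero). *)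

theory Defs
  imports "HOL-Analysis.Analysis"
begin

definition is_domain :: "(complex^'n) set \<Rightarrow> bool" where
  "is_domain \<Omega> \<longleftrightarrow> \<Omega> \<noteq> {} \<and> connected \<Omega> \<and> open \<Omega>"

(* Complex differentiability at every point; intended for open sets. *)
definition holo_fun :: "(complex^'n) set \<Rightarrow> (complex^'n \<Rightarrow> complex) \<Rightarrow> bool" where
  "holo_fun \<Omega> f \<longleftrightarrow>
     (\<forall>z\<in>\<Omega>. \<exists>c::complex^'n. (f has_derivative (\<lambda>h. \<Sum>j\<in>UNIV. c $ j * h $ j)) (at z))"

definition holo_map :: "(complex^'n) set \<Rightarrow> (complex^'n \<Rightarrow> complex^'n) \<Rightarrow> bool" where
  "holo_map \<Omega> f \<longleftrightarrow> (\<forall>j. holo_fun \<Omega> (\<lambda>z. f z $ j))"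

definition biholomorphism ::
  "(complex^'n) set \<Rightarrow> (complex^'n) set \<Rightarrow> (complex^'n \<Rightarrow> complex^'n) \<Rightarrow> bool" where
  "biholomorphism \<Omega> V f \<longleftrightarrow>
     open \<Omega> \<and> open V \<and> bij_betw f \<Omega> V \<and> holo_map \<Omega> f \<and> holo_map V (inv_into \<Omega> f)"

(* Elements are total functions; only their values on \<Omega> are relevant. *)
definition bergman_space :: "(complex^'n) set \<Rightarrow> (complex^'n \<Rightarrow> complex) set" where
  "bergman_space \<Omega> =
     {f. holo_fun \<Omega> f \<and> set_integrable lborel \<Omega> (\<lambda>z. (norm (f z))\<^sup>2)}"

(* Antiholomorphy in w and square integrability of K(z,.) are stated together, as membership of
   its conjugate in the Bergman space; square integrability is what makes the reproducing property
   determine K on \<Omega> \<times> \<Omega>.  Outside \<Omega> \<times> \<Omega> the kernel is normalised to 0. *)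
definition is_bergman_kernel ::
  "(complex^'n) set \<Rightarrow> (complex^'n \<Rightarrow> complex^'n \<Rightarrow> complex) \<Rightarrow> bool" where
  "is_bergman_kernel \<Omega> K \<longleftrightarrow>
     (\<forall>w\<in>\<Omega>. holo_fun \<Omega> (\<lambda>z. K z w)) \<and>
     (\<forall>z\<in>\<Omega>. (\<lambda>w. cnj (K z w)) \<in> bergman_space \<Omega>) \<and>
     (\<forall>f\<in>bergman_space \<Omega>. \<forall>z\<in>\<Omega>. (LINT w:\<Omega>|lborel. f w * K z w) = f z) \<and>
     (\<forall>z w. z \<notin> \<Omega> \<or> w \<notin> \<Omega> \<longrightarrow> K z w = 0)"

(* Every open set has exactly one such kernel, so the else branch only fixes the value of the
   constant at sets that are not open. *)
definition bergman_kernel ::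
  "(complex^'n) set \<Rightarrow> complex^'n \<Rightarrow> complex^'n \<Rightarrow> complex" where
  "bergman_kernel \<Omega> =
     (if \<exists>K. is_bergman_kernel \<Omega> K then (THE K. is_bergman_kernel \<Omega> K) else (\<lambda>z w. 0))"

(* The Wirtinger operator (d/dx_j + i d/dy_j) / 2. *)
definition dbar :: "'n \<Rightarrow> (complex^'n \<Rightarrow> complex) \<Rightarrow> complex^'n \<Rightarrow> complex" where
  "dbar j g w =
     (vector_derivative (\<lambda>t::real. g (w + axis j (of_real t))) (at 0)
      + \<i> * vector_derivative (\<lambda>t::real. g (w + axis j (\<i> * of_real t))) (at 0)) / 2"

(* The coordinates are processed in some fixed order; on smooth functions, such as the
   antiholomorphic ones to which this is applied, the operators commute and the order does not
   matter. *)
definition dbar_multi :: "('n::finite \<Rightarrow> nat) \<Rightarrow> (complex^'n \<Rightarrow> complex) \<Rightarrow> complex^'n \<Rightarrow> complex" where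
  "dbar_multi \<alpha> g =
     foldr (\<lambda>j. dbar j ^^ \<alpha> j) (SOME js. distinct js \<and> set js = UNIV) g"

(* As for the Bergman space, membership only depends on the values on \<Omega>. *)
definition bergman_span :: "(complex^'n) set \<Rightarrow> (complex^'n \<Rightarrow> complex) set" where
  "bergman_span \<Omega> =
     {g. \<exists>(T :: (('n \<Rightarrow> nat) \<times> (complex^'n)) set) c. finite T \<and> (\<forall>(\<alpha>, w0)\<in>T. w0 \<in> \<Omega>) \<and>
        (\<forall>z\<in>\<Omega>. g z =
           (\<Sum>(\<alpha>, w0)\<in>T. c \<alpha> w0 * dbar_multi \<alpha> (\<lambda>w. bergman_kernel \<Omega> z w) w0))}"

definition holo_polynomial :: "(complex^'n \<Rightarrow> complex) \<Rightarrow> bool" where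
  "holo_polynomial p \<longleftrightarrow>
     (\<exists>(A :: ('n \<Rightarrow> nat) set) c. finite A \<and>
        (\<forall>z. p z = (\<Sum>\<alpha>\<in>A. c \<alpha> * (\<Prod>j\<in>UNIV. (z $ j) ^ \<alpha> j))))"

definition quadrature_domain :: "(complex^'n) set \<Rightarrow> bool" where
  "quadrature_domain \<Omega> \<longleftrightarrow>
     is_domain \<Omega> \<and> emeasure lborel \<Omega> < \<infinity> \<and> (\<lambda>z. 1) \<in> bergman_span \<Omega>"

definition QDP :: "(complex^'n) set \<Rightarrow> bool" where
  "QDP \<Omega> \<longleftrightarrow> quadrature_domain \<Omega> \<and> (\<forall>p. holo_polynomial p \<longrightarrow> p \<in> bergman_span \<Omega>)"

(* The quotient g / h is one of meromorphic functions, hence compared with f only where h does not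
   vanish; on a domain this is a dense open set. *)
definition bergman_coordinate :: "(complex^'n) set \<Rightarrow> (complex^'n \<Rightarrow> complex^'n) \<Rightarrow> bool" where
  "bergman_coordinate \<Omega> f \<longleftrightarrow>
     biholomorphism \<Omega> (f ` \<Omega>) f \<and>
     (\<forall>j. \<exists>g\<in>bergman_span \<Omega>. \<exists>h\<in>bergman_span \<Omega>.
        (\<exists>z\<in>\<Omega>. h z \<noteq> 0) \<and> (\<forall>z\<in>\<Omega>. h z \<noteq> 0 \<longrightarrow> f z $ j = g z / h z))"

end

(* With F the inverse of f and u the complex Jacobian determinant of f, the change of variables
   formula shows that u(z) K(f z, f w) cnj(u(w)) is the Bergman kernel of the source domain whenever
   K is that of the target; uniqueness of the kernel suffices, since 1 lies in the Bergman span of V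
   only if V has a kernel.  Differentiating u(z) K(f z, w) = K_source(z, F w) / cnj(u(F w)) in
   cnj w by the chain rule shows that u * (g o f) is in the Bergman span of the source for every g
   in that of V.  Taking g = 1 and g = z_j writes f_j as the quotient (u * f_j) / u. *)

theory Submission
  imports Defs "HOL-Complex_Analysis.Cauchy_Integral_Formula"
begin

section \<open>Real determinants of complex linear maps\<close>

text \<open>The change of variables formula lives on \<open>real^'m\<close> and weighs by the
  absolute value of a real determinant, whereas the kernel transformation needs the weight |det|^2
  of the complex Jacobian. The two are matched algebraically: the real determinant is
  multiplicative, so it suffices to know it on matrices that alter one column of the identity;
  elimination together with a limit reaches all others. The second obstacle is the span. Its
  generators differentiate in a fixed coordinate order, while the chain rule yields further
  derivatives in arbitrary order. Sorting them requires mixed holomorphic partials to commute, and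
  since holomorphy here is only pointwise complex differentiability, even continuity of the first
  partials has to come from Cauchy's integral. Antiholomorphic derivatives are treated throughout as
  conjugates of holomorphic ones. The coefficients produced by the chain rule depend on the point in
  the second variable alone, so one linear combination of generators serves all z, as membership in
  the span demands.\<close>

locale basis_isometry =
  fixes T :: "'a::euclidean_space \<Rightarrow> 'b::euclidean_space" and S :: "'b \<Rightarrow> 'a"
  assumes linear_T: "linear T" and linear_S: "linear S"
    and S_T [simp]: "S (T x) = x" and T_S [simp]: "T (S y) = y"
    and inner_T [simp]: "T x \<bullet> T x' = x \<bullet> x'"
    and bij_S: "bij_betw S Basis Basis"
    and distr_T: "distr lborel borel T = lborel"
begin

lemma norm_T [simp]: "norm (T x) = norm x"
  by (simp add: norm_eq_sqrt_inner)

lemma norm_S [simp]: "norm (S y) = norm y"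
  by (metis norm_T T_S)

end

text \<open>Any bijection of the standard bases extends linearly to such an isometry. It is used
  twice: to identify \<open>complex^'n\<close> with a real coordinate space, and
  \<open>complex\<close> with \<open>real^2\<close>.\<close>

lemma basis_isometry_exists:
  assumes dim: "DIM('a::euclidean_space) = DIM('b::euclidean_space)"
  obtains T :: "'a::euclidean_space \<Rightarrow> 'b::euclidean_space" and S where "basis_isometry T S"
proof -
  obtain \<beta> :: "'a \<Rightarrow> 'b" where \<beta>: "bij_betw \<beta> Basis Basis"
    using finite_same_card_bij[of "Basis :: 'a set" "Basis :: 'b set"] dim by auto
  define T where "T x = (\<Sum>b\<in>Basis. (x \<bullet> b) *\<^sub>R \<beta> b)" for x
  define S where "S y = (\<Sum>b\<in>Basis. (y \<bullet> \<beta> b) *\<^sub>R b)" for y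
  have \<beta>B: "\<beta> b \<in> Basis" if "b \<in> Basis" for b using \<beta> that by (auto dest: bij_betwE)
  have \<beta>\<beta>: "\<beta> b \<bullet> \<beta> b' = (if b = b' then 1 else 0)" if "b \<in> Basis" "b' \<in> Basis" for b b'
    using that \<beta>B inner_Basis[of "\<beta> b" "\<beta> b'"] \<beta> by (auto simp: bij_betw_def inj_on_def)
  have Tb: "T x \<bullet> \<beta> b = x \<bullet> b" if "b \<in> Basis" for x b
  proof -
    have "T x \<bullet> \<beta> b = (\<Sum>b'\<in>Basis. if b' = b then x \<bullet> b' else 0)"
      unfolding T_def inner_sum_left using \<beta>\<beta> that by (intro sum.cong) auto
    then show ?thesis using that by simp
  qed
  have Sb: "S y \<bullet> b = y \<bullet> \<beta> b" if "b \<in> Basis" for y b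
    unfolding S_def using that by simp
  have surj: "\<exists>b\<in>Basis. c = \<beta> b" if "c \<in> Basis" for c
    using \<beta> that by (auto simp: bij_betw_def)
  have ST: "S (T x) = x" for x
    by (rule euclidean_eqI) (simp add: Sb Tb)
  have TS: "T (S y) = y" for y
  proof (rule euclidean_eqI)
    fix c :: 'b assume "c \<in> Basis"
    then obtain b where "b \<in> Basis" "c = \<beta> b" using surj by blast
    then show "T (S y) \<bullet> c = y \<bullet> c" by (simp add: Tb Sb)
  qed
  have lT: "linear T" unfolding T_def
    by (rule linearI) (simp_all add: inner_simps scaleR_add_left sum.distrib scaleR_sum_right)
  have lS: "linear S" unfolding S_def
    by (rule linearI) (simp_all add: inner_simps scaleR_add_left sum.distrib scaleR_sum_right)
  have inT: "T x \<bullet> T x' = x \<bullet> x'" for x x'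
  proof -
    have "T x \<bullet> T x' = (\<Sum>b\<in>Basis. (x' \<bullet> b) * (T x \<bullet> \<beta> b))"
      by (subst T_def[of x']) (simp add: inner_sum_right)
    also have "\<dots> = x \<bullet> x'" by (subst euclidean_inner[of x]) (simp add: Tb mult.commute)
    finally show ?thesis .
  qed
  have S\<beta>: "S (\<beta> b) = b" if "b \<in> Basis" for b
  proof -
    have "S (\<beta> b) = (\<Sum>b'\<in>Basis. if b' = b then b' else 0)"
      unfolding S_def using \<beta>\<beta> that by (intro sum.cong) auto
    then show ?thesis using that by simp
  qed
  have bS: "bij_betw S Basis Basis"
    by (rule bij_betw_byWitness[where f' = \<beta>]) (use S\<beta> \<beta>B surj in \<open>auto, metis+\<close>)
  have mT: "T \<in> borel_measurable borel"
    using lT by (intro borel_measurable_continuous_onI linear_continuous_on) (simp add: linear_conv_bounded_linear)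
  \<comment> \<open>Lebesgue measure is determined by the volumes of boxes. The preimage of a box is
    again a box, with the same side lengths permuted by \<beta>.\<close>
  have "lborel = distr lborel borel T"
  proof (rule lborel_eqI)
    fix l u :: 'b assume le: "\<And>b. b \<in> Basis \<Longrightarrow> l \<bullet> b \<le> u \<bullet> b"
    have "T -` box l u = box (S l) (S u)"
    proof -
      have "x \<in> T -` box l u \<longleftrightarrow> (\<forall>b\<in>Basis. l \<bullet> \<beta> b < T x \<bullet> \<beta> b \<and> T x \<bullet> \<beta> b < u \<bullet> \<beta> b)" for x
        unfolding vimage_eq mem_box using \<beta>B surj by metis
      then show ?thesis by (auto simp: mem_box Sb Tb)
    qed
    then have "emeasure (distr lborel borel T) (box l u) = emeasure lborel (box (S l) (S u))"
      using mT by (simp add: emeasure_distr)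
    also have "\<dots> = (\<Prod>b\<in>Basis. (S u - S l) \<bullet> b)"
      using le \<beta>B by (intro emeasure_lborel_box) (simp add: Sb)
    also have "(\<Prod>b\<in>Basis. (S u - S l) \<bullet> b) = (\<Prod>b\<in>Basis. (u - l) \<bullet> \<beta> b)"
      by (intro prod.cong) (simp_all add: inner_diff_left Sb)
    also have "\<dots> = (\<Prod>b\<in>Basis. (u - l) \<bullet> b)"
      by (rule prod.reindex_bij_betw[OF \<beta>])
    finally show "emeasure (distr lborel borel T) (box l u) = (\<Prod>b\<in>Basis. (u - l) \<bullet> b)" .
  qed simp
  then have "basis_isometry T S"
    using lT lS ST TS inT bS by (intro basis_isometry.intro) auto
  then show thesis by (rule that)
qed

section \<open>Complex matrices as real-linear maps, and matrices differing from the identity in one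
  column\<close>

lemma linear_complex_matrix: "linear ((*v) (A :: complex^'n^'m))"
  by (rule linearI) (simp_all add: vec_eq_iff matrix_vector_mult_def scaleR_sum_right distrib_left sum.distrib)

lemma scaleR_complex_matrix_vector_mult: "(t *\<^sub>R (A :: complex^'n^'m)) *v x = t *\<^sub>R (A *v x)"
  by (simp add: vec_eq_iff matrix_vector_mult_def scaleR_sum_right)

text \<open>These are the elementary factors of column elimination: \<open>v = axis k c\<close>
  gives the scaling of one coordinate, and \<open>v $ k = 1\<close> gives a transvection.\<close>

definition id_with_column :: "'n \<Rightarrow> complex^'n \<Rightarrow> complex^'n^'n" where
  "id_with_column k v = (\<chi> i j. if j = k then v $ i else if i = j then 1 else 0)"

lemma id_with_column_mult_vec:
  "(id_with_column k v *v x) $ i = (if i = k then v $ k * x $ k else v $ i * x $ k + x $ i)"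
proof -
  have "(id_with_column k v *v x) $ i = (\<Sum>j\<in>UNIV. (if j = k then v $ i * x $ j else 0) + (if j = i then if i = k then 0 else x $ j else 0))"
    unfolding matrix_vector_mult_def id_with_column_def by (simp, intro sum.cong) auto
  then show ?thesis by (simp add: sum.distrib)
qed

text \<open>This is the determinant identity behind Cramer's rule, for the coefficient matrix
  \<open>mat 1\<close>.\<close>

lemma det_id_with_column: "det (id_with_column k v) = v $ k"
proof -
  have "id_with_column k v = (\<chi> i j. if j = k then (mat 1 *v v) $ i else mat 1 $ i $ j)"
    unfolding matrix_vector_mul_lid by (simp add: vec_eq_iff id_with_column_def mat_def)
  then show ?thesis by (simp only: cramer_lemma det_I mult_1_right)
qed

lemma column_matrix_mult: "column j (A ** B) = A *v column j (B :: 'a::comm_semiring_1^'n^'m)"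
  by (simp add: vec_eq_iff column_def matrix_matrix_mult_def matrix_vector_mult_def)

section \<open>The real determinant of a complex matrix as a multiplicative invariant\<close>

locale realification = basis_isometry T S
  for T :: "complex^'n \<Rightarrow> real^'m" and S :: "real^'m \<Rightarrow> complex^'n"
begin

text \<open>The absolute value is what enters the change of variables formula, and it gives
  isometries the value 1 without a discussion of signs.\<close>

definition rdet :: "complex^'n^'n \<Rightarrow> real" where
  "rdet A = \<bar>det (matrix (\<lambda>x. T (A *v S x)))\<bar>"

lemma linear_conj: "linear (\<lambda>x. T (A *v S x))"
  using linear_compose[OF linear_compose[OF linear_S linear_complex_matrix] linear_T, of A] by (simp add: o_def)

lemma rdet_mult: "rdet (A ** B) = rdet A * rdet B"
proof -
  have "(\<lambda>x. T ((A ** B) *v S x)) = (\<lambda>x. T (A *v S x)) \<circ> (\<lambda>x. T (B *v S x))"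
    by (simp add: fun_eq_iff matrix_vector_mul_assoc)
  then show ?thesis
    by (simp add: rdet_def matrix_compose[OF linear_conj linear_conj] det_mul abs_mult)
qed

lemma rdet_one: "rdet (mat 1) = 1"
  using matrix_id by (simp add: rdet_def id_def)

text \<open>Conjugation with the isometry \<open>T\<close> preserves norms, so the real matrix is
  orthogonal and its determinant is 1 or -1.\<close>

lemma rdet_eq_one:
  assumes "\<And>x. norm (A *v x) = norm x"
  shows "rdet A = 1"
proof -
  have "orthogonal_transformation (\<lambda>x. T (A *v S x))"
    unfolding orthogonal_transformation using linear_conj assms by simp
  then have "orthogonal_matrix (matrix (\<lambda>x. T (A *v S x)))"
    by (simp add: orthogonal_transformation_matrix)
  then show ?thesis
    unfolding rdet_def using det_orthogonal_matrix by fastforce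
qed

lemma bij_S_axis: "bij_betw (\<lambda>j. S (axis j 1)) UNIV Basis"
proof -
  have "bij_betw (\<lambda>j. axis j 1 :: real^'m) UNIV Basis"
    by (auto simp: bij_betw_def inj_on_def axis_eq_axis Basis_vec_def)
  from bij_betw_trans[OF this bij_S] show ?thesis by (simp add: o_def)
qed

text \<open>In the real basis the map is diagonal: \<open>axis k 1\<close> and
  \<open>axis k \<i>\<close> are both stretched by r and every other basis vector is fixed, whence
  the square.\<close>

lemma rdet_real_scaling:
  "rdet (id_with_column k (axis k (complex_of_real r))) = r\<^sup>2"
proof -
  let ?f = "\<lambda>x. T (id_with_column k (axis k (complex_of_real r)) *v S x)"
  define B where "B = {axis k 1, axis k \<i> :: complex^'n}"
  define \<rho> where "\<rho> b = (if b \<in> B then r else 1)" for b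
  have "?f (axis j 1) = \<rho> (S (axis j 1)) *\<^sub>R axis j 1" for j
  proof -
    have "S (axis j 1) \<in> Basis" using bij_S_axis by (auto dest: bij_betwE)
    then obtain l c where lc: "S (axis j 1) = axis l c" "c = 1 \<or> c = \<i>"
      by (auto simp: Basis_vec_def Basis_complex_def)
    then have "\<rho> (S (axis j 1)) = (if l = k then r else 1)"
      by (auto simp: \<rho>_def B_def axis_eq_axis)
    then have "id_with_column k (axis k (complex_of_real r)) *v S (axis j 1) = \<rho> (S (axis j 1)) *\<^sub>R S (axis j 1)"
      unfolding lc(1) vec_eq_iff by (auto simp: id_with_column_mult_vec axis_def scaleR_conv_of_real[where 'a=complex])
    then show ?thesis by (simp add: linear_scale[OF linear_T])
  qed
  then have M: "matrix ?f $ i $ j = (if i = j then \<rho> (S (axis j 1)) else 0)" for i j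
    by (simp add: matrix_def axis_def)
  have "det (matrix ?f) = (\<Prod>j\<in>UNIV. \<rho> (S (axis j 1)))"
    by (subst det_diagonal) (simp_all add: M)
  also have "\<dots> = (\<Prod>b\<in>Basis. \<rho> b)"
    by (rule prod.reindex_bij_betw[OF bij_S_axis])
  also have "\<dots> = (\<Prod>b\<in>B. \<rho> b)"
    by (rule prod.mono_neutral_right) (auto simp: \<rho>_def B_def Basis_vec_def Basis_complex_def)
  also have "\<dots> = r\<^sup>2"
    by (simp add: \<rho>_def B_def axis_eq_axis power2_eq_square)
  finally show ?thesis by (simp add: rdet_def)
qed

text \<open>Polar decomposition of c: the factor \<open>c / norm c\<close> acts isometrically, so
  only the real scaling by \<open>norm c\<close> contributes.\<close>

lemma rdet_scaling:
  assumes "c \<noteq> 0"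
  shows "rdet (id_with_column k (axis k c)) = (norm c)\<^sup>2"
proof -
  let ?r = "complex_of_real (norm c)"
  have "id_with_column k (axis k c) = id_with_column k (axis k ?r) ** id_with_column k (axis k (c / ?r))"
    unfolding matrix_eq using assms
    by (auto simp: vec_eq_iff id_with_column_mult_vec axis_def simp flip: matrix_vector_mul_assoc)
  moreover have "rdet (id_with_column k (axis k (c / ?r))) = 1"
  proof (rule rdet_eq_one)
    fix x
    have "norm ((id_with_column k (axis k (c / ?r)) *v x) $ i) = norm (x $ i)" for i
      using assms by (simp add: id_with_column_mult_vec axis_def norm_mult norm_divide)
    then show "norm (id_with_column k (axis k (c / ?r)) *v x) = norm x"
      by (simp add: norm_vec_def)
  qed
  ultimately show ?thesis by (simp add: rdet_mult rdet_real_scaling)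
qed

text \<open>Squaring a transvection has the same effect as conjugating it with the scaling by 2 of one
  coordinate, so its multiplicative invariant is idempotent.\<close>

lemma rdet_transvection:
  assumes "w $ k = 1"
  shows "rdet (id_with_column k w) = 1"
proof -
  let ?d = "\<lambda>c. id_with_column k (axis k c)"
  have "id_with_column k w ** id_with_column k w = ?d (1/2) ** id_with_column k w ** ?d 2"
    unfolding matrix_eq using assms
    by (auto simp: vec_eq_iff id_with_column_mult_vec axis_def simp flip: matrix_vector_mul_assoc)
  then have "rdet (id_with_column k w) * rdet (id_with_column k w) = rdet (?d (1/2)) * rdet (id_with_column k w) * rdet (?d 2)"
    by (metis rdet_mult)
  then have "rdet (id_with_column k w) * rdet (id_with_column k w) = rdet (id_with_column k w)"
    by (simp add: rdet_scaling power2_eq_square norm_divide)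
  moreover have "rdet (id_with_column k w) \<noteq> 0"
  proof -
    \<comment> \<open>The inverse transvection: the entry in position k is 2 - 1 = 1, all other
      entries of w are negated.\<close>
    have "id_with_column k w ** id_with_column k (axis k 2 - w) = mat 1"
      unfolding matrix_eq using assms
      by (auto simp: vec_eq_iff id_with_column_mult_vec axis_def simp flip: matrix_vector_mul_assoc)
    then show ?thesis by (metis rdet_mult rdet_one mult_zero_left zero_neq_one)
  qed
  ultimately show ?thesis by simp
qed

text \<open>The matrix scales coordinate k by the pivot \<open>v $ k\<close> and then applies the
  transvection with column \<open>v / v $ k\<close>.\<close>

lemma rdet_id_with_column:
  assumes "v $ k \<noteq> 0"
  shows "rdet (id_with_column k v) = (norm (v $ k))\<^sup>2"
proof -
  let ?w = "\<chi> i. v $ i / v $ k"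
  have "id_with_column k v = id_with_column k ?w ** id_with_column k (axis k (v $ k))"
    unfolding matrix_eq using assms
    by (auto simp: vec_eq_iff id_with_column_mult_vec axis_def simp flip: matrix_vector_mul_assoc)
  then have "rdet (id_with_column k v) = rdet (id_with_column k ?w) * rdet (id_with_column k (axis k (v $ k)))"
    by (metis rdet_mult)
  then show ?thesis using assms by (simp add: rdet_transvection rdet_scaling)
qed

text \<open>Gaussian elimination column by column; a vanishing pivot is handled by perturbing it and
  passing to the limit.\<close>

lemma rdet_eq_aux:
  assumes "finite J" "\<And>j. j \<notin> J \<Longrightarrow> column j A = axis j 1"
  shows "rdet A = (norm (det A))\<^sup>2"
  using assms
proof (induction J arbitrary: A rule: finite_induct)
  case empty
  then have "A = mat 1"
    by (simp add: vec_eq_iff column_def axis_def mat_def)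
  then show ?case by (simp add: rdet_one)
next
  case (insert k J)
  have pivot: "rdet B = (norm (det B))\<^sup>2"
    if B: "\<And>j. j \<notin> insert k J \<Longrightarrow> column j B = axis j 1" and nz: "B $ k $ k \<noteq> 0" for B
  proof -
    define v where "v = column k B"
    have v: "v $ k \<noteq> 0" using nz by (simp add: v_def column_def)
    \<comment> \<open>The column of the inverse of \<open>id_with_column k v\<close>. Multiplying B
      by it turns column k into \<open>axis k 1\<close>, and it fixes the columns
      \<open>axis j 1\<close> that are already cleared, since their entry in position k is
      0.\<close>
    define v' where "v' = (\<chi> i. if i = k then 1 / v $ k else - v $ i / v $ k)"
    let ?B = "id_with_column k v' ** B"
    have "id_with_column k v ** id_with_column k v' = mat 1"
      unfolding matrix_eq using v
      by (auto simp: vec_eq_iff id_with_column_mult_vec v'_def simp flip: matrix_vector_mul_assoc)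
    then have eq: "B = id_with_column k v ** ?B"
      by (simp add: matrix_mul_assoc)
    have "rdet ?B = (norm (det ?B))\<^sup>2"
    proof (rule insert.IH)
      fix j assume j: "j \<notin> J"
      show "column j ?B = axis j 1"
      proof (cases "j = k")
        case True
        then show ?thesis using v
          by (auto simp: column_matrix_mult vec_eq_iff id_with_column_mult_vec v'_def axis_def simp flip: v_def)
      next
        case False
        then show ?thesis using B j
          by (auto simp: column_matrix_mult vec_eq_iff id_with_column_mult_vec axis_def)
      qed
    qed
    then have "rdet (id_with_column k v ** ?B) = (norm (det (id_with_column k v ** ?B)))\<^sup>2"
      by (simp only: rdet_mult det_mul rdet_id_with_column[OF v] det_id_with_column norm_mult power_mult_distrib)
    then show ?thesis using eq by simp
  qed
  show ?case
  proof (cases "A $ k $ k = 0")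
    case False
    with pivot insert.prems show ?thesis by blast
  next
    case True
    \<comment> \<open>Adds t to the pivot entry only, so the cleared columns stay cleared and the
      pivot becomes t.\<close>
    define B where "B t = A + t *\<^sub>R (\<chi> i. if i = k then axis k 1 else 0)" for t
    have Bij: "B t $ i $ j = (if i = k \<and> j = k then of_real t else A $ i $ j)" for t i j
      using True by (auto simp: B_def axis_def scaleR_conv_of_real[where 'a=complex])
    have "rdet (B t) = (norm (det (B t)))\<^sup>2" if "t \<noteq> 0" for t
    proof (rule pivot)
      fix j assume "j \<notin> insert k J"
      then show "column j (B t) = axis j 1"
        using insert.prems[of j] by (auto simp: vec_eq_iff column_def Bij)
    qed (use that in \<open>simp add: Bij\<close>)
    \<comment> \<open>The entries of the real matrix are affine in t, and the determinant is a
      polynomial in its entries.\<close>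
    moreover have "isCont (\<lambda>t. rdet (B t)) 0"
    proof -
      have "(\<chi> i. if i = k then axis k 1 else 0) *v y = axis k (y $ k)" for y :: "complex^'n"
        by (auto simp: vec_eq_iff matrix_vector_mult_def axis_def if_distrib[of "\<lambda>x. x * _"] cong: if_cong)
      then have "B t *v y = A *v y + t *\<^sub>R axis k (y $ k)" for t and y :: "complex^'n"
        by (simp add: B_def matrix_vector_mult_add_rdistrib scaleR_complex_matrix_vector_mult)
      then have "T (B t *v S x) $ i = T (A *v S x) $ i + t * T (axis k (S x $ k)) $ i" for t x i
        by (simp add: linear_add[OF linear_T] linear_scale[OF linear_T])
      then show ?thesis
        unfolding rdet_def det_def matrix_def by (auto intro!: continuous_intros)
    qed
    moreover have "isCont (\<lambda>t. (norm (det (B t)))\<^sup>2) 0"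
    proof -
      have "isCont B 0" unfolding B_def by (intro continuous_intros)
      then show ?thesis unfolding det_def by (intro continuous_intros)
    qed
    ultimately have "rdet (B 0) = (norm (det (B 0)))\<^sup>2"
      unfolding isCont_def
      by (metis (no_types, lifting) LIM_cong LIM_unique)
    moreover have "B 0 = A" by (simp add: B_def)
    ultimately show ?thesis by simp
  qed
qed

lemma rdet_eq: "rdet A = (norm (det A))\<^sup>2"
  by (rule rdet_eq_aux[of UNIV]) auto

end

section \<open>Change of variables\<close>

text \<open>Bridges the integral over \<open>lborel\<close> that defines the Bergman space and the
  Henstock-Kurzweil integral of the change of variables formula. For a Borel measurable integrand,
  completing the measure changes neither integrability nor the value.\<close>

lemma set_integrable_lborel_iff:
  fixes h :: "'a::euclidean_space \<Rightarrow> 'b::euclidean_space"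
  assumes "(\<lambda>x. indicator X x *\<^sub>R h x) \<in> borel_measurable borel"
  shows "set_integrable lborel X h \<longleftrightarrow> h absolutely_integrable_on X"
    and "h absolutely_integrable_on X \<Longrightarrow> (LINT x:X|lborel. h x) = integral X h"
proof -
  have m: "(\<lambda>x. indicator X x *\<^sub>R h x) \<in> borel_measurable lborel" using assms by simp
  show "set_integrable lborel X h \<longleftrightarrow> h absolutely_integrable_on X"
    unfolding set_integrable_def integrable_completion[OF m] ..
  have "(LINT x:X|lborel. h x) = (LINT x:X|lebesgue. h x)"
    unfolding set_lebesgue_integral_def integral_completion[OF m] ..
  then show "h absolutely_integrable_on X \<Longrightarrow> (LINT x:X|lborel. h x) = integral X h"
    by (simp add: set_lebesgue_integral_eq_integral)
qed

context basis_isometry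
begin

lemma bounded_linear_T: "bounded_linear T" and bounded_linear_S: "bounded_linear S"
  using linear_T linear_S by (simp_all add: linear_conv_bounded_linear)

lemma measurable_T: "T \<in> borel_measurable borel" and measurable_S: "S \<in> borel_measurable borel"
  using bounded_linear_T bounded_linear_S
  by (auto intro: borel_measurable_continuous_onI linear_continuous_on)

lemma absolutely_integrable_T_iff:
  "(\<lambda>x. T (h x)) absolutely_integrable_on X \<longleftrightarrow> h absolutely_integrable_on X"
  for h :: "'c::euclidean_space \<Rightarrow> 'a"
proof
  assume "(\<lambda>x. T (h x)) absolutely_integrable_on X"
  from absolutely_integrable_linear[OF this bounded_linear_S]
  show "h absolutely_integrable_on X" by (simp add: o_def)
next
  assume "h absolutely_integrable_on X"
  from absolutely_integrable_linear[OF this bounded_linear_T]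
  show "(\<lambda>x. T (h x)) absolutely_integrable_on X" by (simp add: o_def)
qed

lemma integral_T:
  "h absolutely_integrable_on X \<Longrightarrow> integral X (\<lambda>x. T (h x)) = T (integral X h)"
  for h :: "'c::euclidean_space \<Rightarrow> 'a"
  using integral_linear[OF _ bounded_linear_T, of h X]
  by (simp add: o_def absolutely_integrable_on_def)

lemma
  fixes h :: "'a \<Rightarrow> 'c::euclidean_space"
  assumes meas: "(\<lambda>x. indicator X x *\<^sub>R h x) \<in> borel_measurable borel"
  shows measurable_transport: "(\<lambda>y. indicator (T ` X) y *\<^sub>R h (S y)) \<in> borel_measurable borel"
    and set_integrable_transport: "set_integrable lborel X h \<longleftrightarrow> set_integrable lborel (T ` X) (\<lambda>y. h (S y))"
    and set_integral_transport: "(LINT x:X|lborel. h x) = (LINT y:T ` X|lborel. h (S y))"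
proof -
  have ind: "indicator (T ` X) y = (indicator X (S y) :: real)" for y
    by (auto simp: indicator_def) (metis S_T T_S image_eqI)+
  let ?H = "\<lambda>y. indicator (T ` X) y *\<^sub>R h (S y)"
  show m: "?H \<in> borel_measurable borel"
    unfolding ind by (rule measurable_compose[OF measurable_S meas])
  have T: "T \<in> lborel \<rightarrow>\<^sub>M borel" using measurable_T by simp
  have HT: "?H (T x) = indicator X x *\<^sub>R h x" for x by (simp add: ind)
  show "set_integrable lborel X h \<longleftrightarrow> set_integrable lborel (T ` X) (\<lambda>y. h (S y))"
    unfolding set_integrable_def
    using integrable_distr_eq[OF T m] unfolding distr_T HT by simp
  show "(LINT x:X|lborel. h x) = (LINT y:T ` X|lborel. h (S y))"
    unfolding set_lebesgue_integral_def
    using integral_distr[OF T m] unfolding distr_T HT by simp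
qed

end

text \<open>Complex values are read as vectors in \<open>real^2\<close> through an isometry, which
  commutes with real scaling and with the integral.\<close>

lemma has_absolute_integral_change_of_variables_complex:
  fixes h :: "real^'m::{finite,wellorder} \<Rightarrow> complex" and \<phi> :: "real^'m::_ \<Rightarrow> real^'m::_"
  assumes "X \<in> sets lebesgue"
    and "\<And>x. x \<in> X \<Longrightarrow> (\<phi> has_derivative \<phi>' x) (at x within X)"
    and "inj_on \<phi> X"
  shows "(\<lambda>x. \<bar>det (matrix (\<phi>' x))\<bar> *\<^sub>R h (\<phi> x)) absolutely_integrable_on X \<and>
           integral X (\<lambda>x. \<bar>det (matrix (\<phi>' x))\<bar> *\<^sub>R h (\<phi> x)) = b
     \<longleftrightarrow> h absolutely_integrable_on (\<phi> ` X) \<and> integral (\<phi> ` X) h = b"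
proof -
  obtain R :: "complex \<Rightarrow> real^2" and R' where "basis_isometry R R'"
    using basis_isometry_exists[where 'a=complex and 'b="real^2"] by auto
  then interpret R: basis_isometry R R' .
  have inj: "R u = R v \<longleftrightarrow> u = v" for u v by (metis R.S_T)
  have sc: "r *\<^sub>R R u = R (r *\<^sub>R u)" for r u by (simp add: linear_scale[OF R.linear_T])
  show ?thesis
    using has_absolute_integral_change_of_variables[OF assms, of "\<lambda>y. R (h y)" "R b"]
    unfolding sc R.absolutely_integrable_T_iff
    by (auto simp: R.integral_T inj)
qed

text \<open>Both integrals are carried to a real coordinate space along \<open>T\<close>. There the
  weight of the real formula is \<open>rdet (A z)\<close>, which equals the squared modulus of the
  complex determinant.\<close>

lemma
  fixes f :: "complex^'n \<Rightarrow> complex^'n" and A :: "complex^'n \<Rightarrow> complex^'n^'n"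
    and g :: "complex^'n \<Rightarrow> complex"
  assumes op: "open \<Omega>" "open (f ` \<Omega>)" and inj: "inj_on f \<Omega>"
    and der: "\<And>z. z \<in> \<Omega> \<Longrightarrow> (f has_derivative (\<lambda>h. A z *v h)) (at z)"
    and contA: "continuous_on \<Omega> (\<lambda>z. det (A z))" and contg: "continuous_on (f ` \<Omega>) g"
  shows set_integrable_change_of_variables:
      "set_integrable lborel (f ` \<Omega>) g \<longleftrightarrow>
       set_integrable lborel \<Omega> (\<lambda>z. (norm (det (A z)))\<^sup>2 *\<^sub>R g (f z))" (is ?int)
    and set_integral_change_of_variables:
      "(LINT w:f ` \<Omega>|lborel. g w) = (LINT z:\<Omega>|lborel. (norm (det (A z)))\<^sup>2 *\<^sub>R g (f z))" (is ?eq)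
proof -
  \<comment> \<open>The index type \<open>'n bit0\<close> has twice as many elements as \<open>'n\<close>, and it is a wellorder, as the
    library's change of variables requires.\<close>
  obtain T :: "complex^'n \<Rightarrow> real^('n bit0)" and S where TS: "basis_isometry T S"
    using basis_isometry_exists[where 'a="complex^'n" and 'b="real^('n bit0)"] by auto
  interpret realification T S by (rule realification.intro[OF TS])
  let ?G = "\<lambda>z. (norm (det (A z)))\<^sup>2 *\<^sub>R g (f z)"
  have contf: "continuous_on \<Omega> f"
    using der by (meson has_derivative_at_withinI has_derivative_continuous_on)
  have mg: "(\<lambda>w. indicator (f ` \<Omega>) w *\<^sub>R g w) \<in> borel_measurable borel"
    using borel_measurable_continuous_on_indicator[OF _ contg] op(2) by simp
  have "continuous_on \<Omega> ?G"
    by (intro continuous_intros contA continuous_on_compose2[OF contg contf]) auto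
  then have mG: "(\<lambda>z. indicator \<Omega> z *\<^sub>R ?G z) \<in> borel_measurable borel"
    by (rule borel_measurable_continuous_on_indicator[rotated]) (use op(1) in simp)
  define \<phi> where "\<phi> x = T (f (S x))" for x
  define \<phi>' where "\<phi>' x y = T (A (S x) *v S y)" for x y
  have im: "\<phi> ` (T ` \<Omega>) = T ` f ` \<Omega>"
    by (auto simp: \<phi>_def image_image)
  have "open (S -` \<Omega>)"
    using continuous_open_vimage[OF op(1)] linear_continuous_at[OF bounded_linear_S] by blast
  moreover have "S -` \<Omega> = T ` \<Omega>" by (auto simp: image_iff) (metis T_S)
  ultimately have "T ` \<Omega> \<in> sets lebesgue" by simp
  moreover have "(\<phi> has_derivative \<phi>' x) (at x within T ` \<Omega>)" if "x \<in> T ` \<Omega>" for x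
  proof -
    have "S x \<in> \<Omega>" using that by auto
    from bounded_linear.has_derivative[OF bounded_linear_T
        has_derivative_compose[OF bounded_linear.has_derivative[OF bounded_linear_S has_derivative_ident] der[OF this]]]
    show ?thesis unfolding \<phi>_def[abs_def] \<phi>'_def[abs_def] .
  qed
  moreover have "inj_on \<phi> (T ` \<Omega>)"
    using inj by (auto simp: inj_on_def \<phi>_def) (metis S_T)+
  ultimately have cov: "(\<lambda>x. \<bar>det (matrix (\<phi>' x))\<bar> *\<^sub>R g (S (\<phi> x))) absolutely_integrable_on T ` \<Omega> \<and>
           integral (T ` \<Omega>) (\<lambda>x. \<bar>det (matrix (\<phi>' x))\<bar> *\<^sub>R g (S (\<phi> x))) = b
     \<longleftrightarrow> (\<lambda>x. g (S x)) absolutely_integrable_on (\<phi> ` T ` \<Omega>) \<and> integral (\<phi> ` T ` \<Omega>) (\<lambda>x. g (S x)) = b" for b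
    by (rule has_absolute_integral_change_of_variables_complex)
  have eq: "\<bar>det (matrix (\<phi>' x))\<bar> *\<^sub>R g (S (\<phi> x)) = ?G (S x)" for x
    using rdet_eq[of "A (S x)"] by (simp add: rdet_def \<phi>_def \<phi>'_def[abs_def])
  note tG = measurable_transport[OF mG] and tg = measurable_transport[OF mg]
  have iff: "(\<lambda>x. ?G (S x)) absolutely_integrable_on T ` \<Omega> \<longleftrightarrow> (\<lambda>x. g (S x)) absolutely_integrable_on T ` f ` \<Omega>"
    and inteq: "(\<lambda>x. ?G (S x)) absolutely_integrable_on T ` \<Omega> \<Longrightarrow>
       integral (T ` \<Omega>) (\<lambda>x. ?G (S x)) = integral (T ` f ` \<Omega>) (\<lambda>x. g (S x))"
    using cov unfolding eq im by blast+
  show ?int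
    using iff set_integrable_lborel_iff(1)[OF tG] set_integrable_lborel_iff(1)[OF tg]
      set_integrable_transport[OF mG] set_integrable_transport[OF mg] by simp
  show ?eq
  proof (cases "set_integrable lborel \<Omega> ?G")
    case True
    with set_integrable_transport[OF mG] set_integrable_lborel_iff(1)[OF tG]
    have i: "(\<lambda>x. ?G (S x)) absolutely_integrable_on T ` \<Omega>" by simp
    show ?thesis
      using inteq[OF i] set_integrable_lborel_iff(2)[OF tG i] set_integrable_lborel_iff(2)[OF tg iff[THEN iffD1, OF i]]
        set_integral_transport[OF mG] set_integral_transport[OF mg] by simp
  next
    \<comment> \<open>Neither integrand is integrable, so both integrals have the default value
      0.\<close>
    case False
    with \<open>?int\<close> show ?thesis
      unfolding set_integrable_def set_lebesgue_integral_def by (simp add: not_integrable_integral_eq)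
  qed
qed

section \<open>Holomorphic functions of several variables\<close>

text \<open>Taken as a one-variable complex derivative along a coordinate line, so that Cauchy's
  formula in the plane applies directly.\<close>

definition cpartial :: "'n \<Rightarrow> (complex^'n \<Rightarrow> complex) \<Rightarrow> complex^'n \<Rightarrow> complex" where
  "cpartial j \<phi> z = deriv (\<lambda>t. \<phi> (z + axis j t)) 0"

lemma bounded_linear_axis: "bounded_linear (axis j :: complex \<Rightarrow> complex^'n)"
  by (rule linear_conv_bounded_linear[THEN iffD1], rule linearI)
     (auto simp: vec_eq_iff axis_def)

lemma norm_axis: "norm (axis j x :: complex^'n) = norm x"
proof -
  have "(\<Sum>i\<in>UNIV. (norm ((axis j x :: complex^'n) $ i))\<^sup>2) = (\<Sum>i\<in>UNIV. if i = j then (norm x)\<^sup>2 else 0)"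
    by (rule sum.cong) (auto simp: axis_def)
  then show ?thesis by (simp add: norm_vec_def L2_set_def)
qed

lemma has_derivative_axis_line:
  "((\<lambda>t. z + axis j t) has_derivative axis j) (at t within S)"
  for z :: "complex^'n"
  using has_derivative_add[OF has_derivative_const bounded_linear.has_derivative[OF bounded_linear_axis has_derivative_ident]]
  by simp

lemma sum_mult_axis: "(\<Sum>k\<in>UNIV. c k * axis j t $ k) = c j * (t::complex)"
proof -
  have "(\<Sum>k\<in>UNIV. c k * axis j t $ k) = (\<Sum>k\<in>UNIV. if k = j then c k * t else 0)"
    by (rule sum.cong) (auto simp: axis_def)
  then show ?thesis by simp
qed

lemma has_derivative_imp_line:
  fixes \<phi> :: "complex^'n \<Rightarrow> complex"
  assumes "(\<phi> has_derivative (\<lambda>h. \<Sum>j\<in>UNIV. c j * h $ j)) (at (z + axis j t))"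
  shows "((\<lambda>t. \<phi> (z + axis j t)) has_field_derivative c j) (at t)"
  using has_derivative_compose[OF has_derivative_axis_line assms, of UNIV]
  by (simp add: has_field_derivative_def sum_mult_axis)

lemma cpartial_eq:
  assumes "(\<phi> has_derivative (\<lambda>h. \<Sum>j\<in>UNIV. c j * h $ j)) (at z)"
  shows "cpartial j \<phi> z = c j"
proof -
  have "axis j 0 = (0 :: complex^'a)" by (simp add: vec_eq_iff axis_def)
  then show ?thesis
    unfolding cpartial_def using has_derivative_imp_line[of \<phi> c z j 0] assms
    by (intro DERIV_imp_deriv) (simp only: add_0_right)
qed

lemma holo_fun_has_derivative:
  assumes "holo_fun \<Omega> \<phi>" "z \<in> \<Omega>"
  shows "(\<phi> has_derivative (\<lambda>h. \<Sum>j\<in>UNIV. cpartial j \<phi> z * h $ j)) (at z)"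
proof -
  obtain c where c: "(\<phi> has_derivative (\<lambda>h. \<Sum>j\<in>UNIV. c $ j * h $ j)) (at z)"
    using assms unfolding holo_fun_def by blast
  have "cpartial j \<phi> z = c $ j" for j by (rule cpartial_eq[OF c])
  with c show ?thesis by simp
qed

lemma holo_funI:
  assumes "\<And>z. z \<in> \<Omega> \<Longrightarrow> (\<phi> has_derivative (\<lambda>h. \<Sum>j\<in>UNIV. c z j * h $ j)) (at z)"
  shows "holo_fun \<Omega> \<phi>"
  unfolding holo_fun_def
proof
  fix z assume "z \<in> \<Omega>"
  from assms[OF this] show "\<exists>d::complex^'a. (\<phi> has_derivative (\<lambda>h. \<Sum>j\<in>UNIV. d $ j * h $ j)) (at z)"
    by (intro exI[of _ "\<chi> j. c z j"]) simp
qed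

lemma holo_fun_continuous_on: "holo_fun \<Omega> \<phi> \<Longrightarrow> continuous_on \<Omega> \<phi>"
  by (meson holo_fun_has_derivative has_derivative_at_withinI has_derivative_continuous_on)

lemma holo_fun_cong:
  assumes "open \<Omega>" "holo_fun \<Omega> \<phi>" "\<And>z. z \<in> \<Omega> \<Longrightarrow> \<psi> z = \<phi> z"
  shows "holo_fun \<Omega> \<psi>"
proof (rule holo_funI)
  fix z assume z: "z \<in> \<Omega>"
  show "(\<psi> has_derivative (\<lambda>h. \<Sum>j\<in>UNIV. cpartial j \<phi> z * h $ j)) (at z)"
    by (rule has_derivative_transform_within_open[OF holo_fun_has_derivative[OF assms(2) z] assms(1) z])
       (simp add: assms(3))
qed

lemma cpartial_cong:
  assumes "open \<Omega>" "holo_fun \<Omega> \<phi>" "\<And>z. z \<in> \<Omega> \<Longrightarrow> \<psi> z = \<phi> z" "z \<in> \<Omega>"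
  shows "cpartial j \<psi> z = cpartial j \<phi> z"
  by (rule cpartial_eq, rule has_derivative_transform_within_open[OF holo_fun_has_derivative[OF assms(2,4)] assms(1,4)])
     (simp add: assms(3))

lemma holo_fun_const: "holo_fun \<Omega> (\<lambda>z. c)"
  by (rule holo_funI[where c = "\<lambda>_ _. 0"]) simp

lemma
  assumes "holo_fun \<Omega> \<phi>" "holo_fun \<Omega> \<psi>"
  shows holo_fun_add: "holo_fun \<Omega> (\<lambda>z. \<phi> z + \<psi> z)"
    and holo_fun_mult: "holo_fun \<Omega> (\<lambda>z. \<phi> z * \<psi> z)"
    and cpartial_add: "z \<in> \<Omega> \<Longrightarrow> cpartial j (\<lambda>z. \<phi> z + \<psi> z) z = cpartial j \<phi> z + cpartial j \<psi> z"
    and cpartial_mult: "z \<in> \<Omega> \<Longrightarrow> cpartial j (\<lambda>z. \<phi> z * \<psi> z) z = cpartial j \<phi> z * \<psi> z + \<phi> z * cpartial j \<psi> z"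
proof -
  note D = holo_fun_has_derivative[OF assms(1)] holo_fun_has_derivative[OF assms(2)]
  have a: "((\<lambda>z. \<phi> z + \<psi> z) has_derivative (\<lambda>h. \<Sum>j\<in>UNIV. (cpartial j \<phi> z + cpartial j \<psi> z) * h $ j)) (at z)"
    if "z \<in> \<Omega>" for z
    using has_derivative_add[OF D(1) D(2), OF that that] by (simp add: distrib_right sum.distrib)
  have m: "((\<lambda>z. \<phi> z * \<psi> z) has_derivative
      (\<lambda>h. \<Sum>j\<in>UNIV. (cpartial j \<phi> z * \<psi> z + \<phi> z * cpartial j \<psi> z) * h $ j)) (at z)"
    if "z \<in> \<Omega>" for z
    by (rule has_derivative_eq_rhs[OF has_derivative_mult[OF D(1) D(2), OF that that]])
       (simp add: algebra_simps sum.distrib sum_distrib_left)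
  show "holo_fun \<Omega> (\<lambda>z. \<phi> z + \<psi> z)" "holo_fun \<Omega> (\<lambda>z. \<phi> z * \<psi> z)"
    by (rule holo_funI[OF a] holo_funI[OF m]; assumption)+
  show "z \<in> \<Omega> \<Longrightarrow> cpartial j (\<lambda>z. \<phi> z + \<psi> z) z = cpartial j \<phi> z + cpartial j \<psi> z"
    "z \<in> \<Omega> \<Longrightarrow> cpartial j (\<lambda>z. \<phi> z * \<psi> z) z = cpartial j \<phi> z * \<psi> z + \<phi> z * cpartial j \<psi> z"
    using cpartial_eq[OF a] cpartial_eq[OF m] by blast+
qed

lemma holo_fun_sum:
  "(\<And>i. i \<in> I \<Longrightarrow> holo_fun \<Omega> (\<phi> i)) \<Longrightarrow> holo_fun \<Omega> (\<lambda>z. \<Sum>i\<in>I. \<phi> i z)"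
  by (induction I rule: infinite_finite_induct) (auto intro: holo_fun_const holo_fun_add)

lemma holo_fun_prod:
  "(\<And>i. i \<in> I \<Longrightarrow> holo_fun \<Omega> (\<phi> i)) \<Longrightarrow> holo_fun \<Omega> (\<lambda>z. \<Prod>i\<in>I. \<phi> i z)"
  by (induction I rule: infinite_finite_induct) (auto intro: holo_fun_const holo_fun_mult)

lemma holo_fun_inverse:
  assumes "holo_fun \<Omega> \<phi>" "\<And>z. z \<in> \<Omega> \<Longrightarrow> \<phi> z \<noteq> 0"
  shows "holo_fun \<Omega> (\<lambda>z. inverse (\<phi> z))"
proof (rule holo_funI)
  fix z assume z: "z \<in> \<Omega>"
  show "((\<lambda>z. inverse (\<phi> z)) has_derivative
     (\<lambda>h. \<Sum>j\<in>UNIV. (- (inverse (\<phi> z) * cpartial j \<phi> z * inverse (\<phi> z))) * h $ j)) (at z)"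
    by (rule has_derivative_eq_rhs[OF Deriv.has_derivative_inverse[OF assms(2)[OF z] holo_fun_has_derivative[OF assms(1) z]]])
       (simp add: sum_distrib_left sum_distrib_right mult_ac flip: sum_negf)
qed

lemma has_derivative_vecI:
  fixes f :: "'a::real_normed_vector \<Rightarrow> complex^'n"
  assumes "\<And>i. ((\<lambda>z. f z $ i) has_derivative (\<lambda>h. f' h $ i)) F"
  shows "(f has_derivative f') F"
proof -
  have *: "x = (\<Sum>i\<in>UNIV. axis i (x $ i))" for x :: "complex^'n"
    by (simp add: vec_eq_iff axis_def)
  have "((\<lambda>z. \<Sum>i\<in>UNIV. axis i (f z $ i)) has_derivative (\<lambda>h. \<Sum>i\<in>UNIV. axis i (f' h $ i))) F"
    by (intro has_derivative_sum bounded_linear.has_derivative[OF bounded_linear_axis] assms)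
  then show ?thesis by (simp flip: *)
qed

definition jac :: "(complex^'n \<Rightarrow> complex^'n) \<Rightarrow> complex^'n \<Rightarrow> complex^'n^'n" where
  "jac f z = (\<chi> i j. cpartial j (\<lambda>z. f z $ i) z)"

lemma holo_map_has_derivative:
  assumes "holo_map \<Omega> f" "z \<in> \<Omega>"
  shows "(f has_derivative (\<lambda>h. jac f z *v h)) (at z)"
  using assms unfolding holo_map_def
  by (intro has_derivative_vecI) (auto simp: jac_def matrix_vector_mult_def intro!: holo_fun_has_derivative)

lemma
  fixes f :: "complex^'n \<Rightarrow> complex^'n"
  assumes f: "holo_map \<Omega> f" and \<phi>: "holo_fun V \<phi>" and sub: "f ` \<Omega> \<subseteq> V"
  shows holo_fun_compose: "holo_fun \<Omega> (\<lambda>z. \<phi> (f z))"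
    and cpartial_compose: "z \<in> \<Omega> \<Longrightarrow> cpartial j (\<lambda>z. \<phi> (f z)) z = (\<Sum>k\<in>UNIV. cpartial k \<phi> (f z) * cpartial j (\<lambda>z. f z $ k) z)"
proof -
  have D: "((\<lambda>z. \<phi> (f z)) has_derivative
      (\<lambda>h. \<Sum>j\<in>UNIV. (\<Sum>k\<in>UNIV. cpartial k \<phi> (f z) * cpartial j (\<lambda>z. f z $ k) z) * h $ j)) (at z)"
    if z: "z \<in> \<Omega>" for z
  proof (rule has_derivative_eq_rhs[OF has_derivative_compose[OF holo_map_has_derivative[OF f z] 
          holo_fun_has_derivative[OF \<phi>]]])
    show "f z \<in> V" using sub z by auto
    show "(\<lambda>h. \<Sum>k\<in>UNIV. cpartial k \<phi> (f z) * (jac f z *v h) $ k) =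
      (\<lambda>h. \<Sum>j\<in>UNIV. (\<Sum>k\<in>UNIV. cpartial k \<phi> (f z) * cpartial j (\<lambda>z. f z $ k) z) * h $ j)"
    proof
      fix h :: "complex^'n"
      have "(\<Sum>k\<in>UNIV. cpartial k \<phi> (f z) * (jac f z *v h) $ k) =
        (\<Sum>k\<in>UNIV. \<Sum>j\<in>UNIV. cpartial k \<phi> (f z) * cpartial j (\<lambda>z. f z $ k) z * h $ j)"
        by (simp add: jac_def matrix_vector_mult_def sum_distrib_left mult.assoc)
      also have "\<dots> = (\<Sum>j\<in>UNIV. (\<Sum>k\<in>UNIV. cpartial k \<phi> (f z) * cpartial j (\<lambda>z. f z $ k) z) * h $ j)"
        by (subst sum.swap) (simp add: sum_distrib_right)
      finally show "(\<Sum>k\<in>UNIV. cpartial k \<phi> (f z) * (jac f z *v h) $ k) =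
        (\<Sum>j\<in>UNIV. (\<Sum>k\<in>UNIV. cpartial k \<phi> (f z) * cpartial j (\<lambda>z. f z $ k) z) * h $ j)" .
    qed
  qed
  show "holo_fun \<Omega> (\<lambda>z. \<phi> (f z))" using D by (rule holo_funI)
  show "z \<in> \<Omega> \<Longrightarrow> cpartial j (\<lambda>z. \<phi> (f z)) z = (\<Sum>k\<in>UNIV. cpartial k \<phi> (f z) * cpartial j (\<lambda>z. f z $ k) z)"
    using cpartial_eq[OF D] by blast
qed

text \<open>Cauchy's formula for the derivative at 0 along the coordinate line, with the circle
  parametrised over [0,1]. The velocity of the circle cancels one of the two factors of the
  denominator and the constant 2 pi i. Because the parameter domain does not move with z, the right
  side can be differentiated under the integral sign.\<close>

lemma cpartial_cauchy:
  fixes z :: "complex^'n"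
  assumes hol: "holo_fun \<Omega> \<phi>" and r: "r > 0" and sub: "cball z r \<subseteq> \<Omega>"
  shows "cpartial j \<phi> z = integral (cbox 0 1) (\<lambda>t::real. \<phi> (z + axis j (r * exp (2 * pi * \<i> * t))) / (r * exp (2 * pi * \<i> * t)))"
proof -
  define g where "g t = \<phi> (z + axis j t)" for t
  have inO: "z + axis j t \<in> \<Omega>" if "t \<in> cball 0 r" for t
  proof -
    have "norm (axis j t) = norm t" by (simp add: norm_axis)
    then have "z + axis j t \<in> cball z r" using that by (simp add: dist_norm)
    then show ?thesis using sub by blast
  qed
  have g: "(g has_field_derivative cpartial j \<phi> (z + axis j t)) (at t)" if "t \<in> cball 0 r" for t
    unfolding g_def
    by (rule has_derivative_imp_line[where c="\<lambda>j'. cpartial j' \<phi> (z + axis j t)"])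
       (rule holo_fun_has_derivative[OF hol inO[OF that]])
  have hol: "g holomorphic_on cball 0 r"
    using g by (meson field_differentiable_at_within field_differentiable_def holomorphic_onI)
  have "(g has_field_derivative (1 / (2 * of_real pi * \<i>) * contour_integral(circlepath 0 r) (\<lambda>u. g u / (u-0)^2))) (at 0)"
    by (rule Cauchy_derivative_integral_circlepath)
       (use hol r in \<open>auto intro: holomorphic_on_imp_continuous_on holomorphic_on_subset\<close>)
  then have "cpartial j \<phi> z = 1 / (2 * of_real pi * \<i>) * contour_integral(circlepath 0 r) (\<lambda>u. g u / (u-0)^2)"
    by (simp add: cpartial_def g_def[abs_def] DERIV_imp_deriv)
  also have "contour_integral(circlepath 0 r) (\<lambda>u. g u / (u-0)^2) =
    integral {0..1} (\<lambda>t::real. (2 * of_real pi * \<i>) * (g (r * exp (2 * pi * \<i> * t)) / (r * exp (2 * pi * \<i> * t))))"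
    unfolding contour_integral_integral
    by (intro Henstock_Kurzweil_Integration.integral_cong) (use r in \<open>simp only: vector_derivative_circlepath, simp add: circlepath power2_eq_square field_simps\<close>)
  also have "1 / (2 * of_real pi * \<i>) * \<dots> =
     integral {0..1} (\<lambda>t::real. (g (r * exp (2 * pi * \<i> * t)) / (r * exp (2 * pi * \<i> * t))))"
    by (simp only: Henstock_Kurzweil_Integration.integral_mult_right) simp
  finally show ?thesis by (simp add: g_def)
qed

text \<open>Near a point one radius serves all centres, so a partial derivative is there an integral
  over [0,1] depending on the parameter z. Continuity of parameter integrals first makes the first
  partials continuous; this is the hypothesis under which the Leibniz rule then differentiates the
  integral once more.\<close>

lemma
  fixes \<phi> :: "complex^'n \<Rightarrow> complex"
  assumes op: "open \<Omega>" and hol: "holo_fun \<Omega> \<phi>"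
  shows holo_fun_cpartial: "holo_fun \<Omega> (cpartial j \<phi>)"
    and cpartial_commute: "z \<in> \<Omega> \<Longrightarrow> cpartial k (cpartial j \<phi>) z = cpartial j (cpartial k \<phi>) z"
proof -
  define e where "e r t = complex_of_real r * exp (2 * pi * \<i> * complex_of_real t)" for r t
  have ce: "continuous_on S (e r)" for S r
    unfolding e_def by (intro continuous_intros)
  have ne: "e r t \<noteq> 0" if "r > 0" for r t using that by (simp add: e_def)
  have nme: "norm (e r t) = r" if "r > 0" for r t
    using that by (simp add: e_def norm_mult norm_exp_eq_Re)
  have ball: "\<exists>r>0. \<forall>z\<in>ball z0 r. cball z r \<subseteq> \<Omega>" if z0: "z0 \<in> \<Omega>" for z0
  proof -
    obtain s where s: "s > 0" "ball z0 s \<subseteq> \<Omega>" by (rule openE[OF op z0])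
    \<comment> \<open>Centres lie within s/3 of \<open>z0\<close> and the discs about them have
      radius s/3, so everything stays inside the ball of radius s.\<close>
    have "cball z (s/3) \<subseteq> \<Omega>" if "z \<in> ball z0 (s/3)" for z
    proof
      fix y assume "y \<in> cball z (s/3)"
      then have "dist z y \<le> s/3" "dist z0 z < s/3" using that by simp_all
      then have "dist z0 y < s" using s(1) dist_triangle[of z0 y z] by linarith
      then show "y \<in> \<Omega>" using s(2) by (meson mem_ball subsetD)
    qed
    moreover have "s/3 > 0" using s(1) by simp
    ultimately show ?thesis by blast
  qed
  have inO: "z + axis i (e r t) \<in> \<Omega>" if "cball z r \<subseteq> \<Omega>" "r > 0" for z i r t
  proof -
    have "norm (axis i (e r t) :: complex^'n) = r" by (simp only: norm_axis nme[OF that(2)])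
    then have "z + axis i (e r t) \<in> cball z r" by (simp add: dist_norm)
    then show ?thesis using that(1) by blast
  qed
  have caxis: "continuous_on S (\<lambda>x. axis i (g x) :: complex^'n)" if "continuous_on S g" for S i and g :: "'x::topological_space \<Rightarrow> complex"
    using bounded_linear.continuous_on[OF bounded_linear_axis that] .
  have cpar: "continuous_on (U \<times> T) (\<lambda>(x,t). \<psi> (x + axis i (e r t)) / e r t)"
    if "continuous_on \<Omega> \<psi>" "r > 0" "\<forall>z\<in>U. cball z r \<subseteq> \<Omega>" for U T i r and \<psi> :: "complex^'n \<Rightarrow> complex"
    unfolding case_prod_unfold
    by (intro continuous_intros continuous_on_compose2[OF that(1)] caxis continuous_on_compose2[OF ce])
       (use that ne inO in auto)
  have cslice: "continuous_on T (\<lambda>t. \<psi> (z + axis i (e r t)) / e r t)"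
    if "continuous_on \<Omega> \<psi>" "r > 0" "cball z r \<subseteq> \<Omega>" for T i r z and \<psi> :: "complex^'n \<Rightarrow> complex"
    by (intro continuous_intros continuous_on_compose2[OF that(1)] caxis ce)
       (use that ne inO in auto)
  have cauchy: "cpartial i \<psi> z = integral (cbox 0 1) (\<lambda>t. \<psi> (z + axis i (e r t)) / e r t)"
    if "holo_fun \<Omega> \<psi>" "r > 0" "cball z r \<subseteq> \<Omega>" for i \<psi> z r
    unfolding e_def by (rule cpartial_cauchy[OF that])
  have contpd: "continuous_on \<Omega> (cpartial i \<phi>)" for i
  proof (rule continuous_at_imp_continuous_on, rule)
    fix z0 assume "z0 \<in> \<Omega>"
    then obtain r where r: "r > 0" "\<forall>z\<in>ball z0 r. cball z r \<subseteq> \<Omega>" using ball by blast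
    have "continuous_on (ball z0 r) (\<lambda>z. integral (cbox 0 1) (\<lambda>t. \<phi> (z + axis i (e r t)) / e r t))"
      by (rule integral_continuous_on_param[OF cpar[OF holo_fun_continuous_on[OF hol] r]])
    then have "continuous_on (ball z0 r) (cpartial i \<phi>)"
      by (rule continuous_on_eq) (use cauchy[OF hol r(1)] r(2) in auto)
    then show "isCont (cpartial i \<phi>) z0"
      using r(1) by (simp add: continuous_on_eq_continuous_at)
  qed
  have key: "((cpartial j \<phi>) has_derivative
      (\<lambda>h. \<Sum>k\<in>UNIV. integral (cbox 0 1) (\<lambda>t. cpartial k \<phi> (z0 + axis j (e r t)) / e r t) * h $ k)) (at z0)"
    if z0: "z0 \<in> \<Omega>" and r: "r > 0" "\<forall>z\<in>ball z0 r. cball z r \<subseteq> \<Omega>" for z0 j r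
  proof -
    \<comment> \<open>The Leibniz rule asks for a derivative that is jointly continuous as a map
      into the bounded linear operators, so the coordinate projections are packaged as such
      operators.\<close>
    define P :: "'n \<Rightarrow> ((complex^'n) \<Rightarrow>\<^sub>L complex)" where "P k = Blinfun (\<lambda>h. h $ k)" for k
    have P: "blinfun_apply (P k) h = h $ k" for k h
      unfolding P_def by (subst bounded_linear_Blinfun_apply) auto
    define fx where "fx z t = (\<Sum>k\<in>UNIV. blinfun_mult_right (cpartial k \<phi> (z + axis j (e r t)) / e r t) o\<^sub>L P k)" for z t
    have fx: "blinfun_apply (fx z t) h = (\<Sum>k\<in>UNIV. (cpartial k \<phi> (z + axis j (e r t)) / e r t) * h $ k)" for z t h
      by (simp add: fx_def blinfun.sum_left P)
    let ?U = "ball z0 r"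
    have cfx: "continuous_on (?U \<times> cbox 0 1) (\<lambda>(z,t). fx z t)"
    proof -
      have c: "continuous_on (?U \<times> cbox 0 1) (\<lambda>p. cpartial k \<phi> (fst p + axis j (e r (snd p))) / e r (snd p))" for k
        using cpar[OF contpd r] by (simp add: case_prod_unfold)
      then show ?thesis
        unfolding fx_def case_prod_unfold
        by (intro continuous_on_sum bounded_bilinear.continuous_on[OF bounded_bilinear_blinfun_compose]
              bounded_linear.continuous_on[OF bounded_linear_blinfun_mult_right] continuous_on_const c)
    qed
    have "((\<lambda>z. integral (cbox 0 1) (\<lambda>t. \<phi> (z + axis j (e r t)) / e r t)) has_derivative
       integral (cbox 0 1) (fx z0)) (at z0 within ?U)"
    proof (rule leibniz_rule[OF _ _ cfx])
      show "((\<lambda>z. \<phi> (z + axis j (e r t)) / e r t) has_derivative blinfun_apply (fx z t)) (at z within ball z0 r)"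
        if "z \<in> ?U" for z t
      proof -
        have l: "((\<lambda>z. z + axis j (e r t)) has_derivative (\<lambda>h. h)) (at z within ?U)"
          by (auto intro!: derivative_eq_intros)
        have d: "(\<phi> has_derivative (\<lambda>h. \<Sum>k\<in>UNIV. cpartial k \<phi> (z + axis j (e r t)) * h $ k)) (at (z + axis j (e r t)))"
          using holo_fun_has_derivative[OF hol inO] r that by blast
        have "((\<lambda>z. \<phi> (z + axis j (e r t))) has_derivative (\<lambda>h. \<Sum>k\<in>UNIV. cpartial k \<phi> (z + axis j (e r t)) * h $ k)) (at z within ?U)"
          by (rule has_derivative_compose[OF l d])
        then have "((\<lambda>z. \<phi> (z + axis j (e r t)) * inverse (e r t)) has_derivative
            (\<lambda>h. (\<Sum>k\<in>UNIV. cpartial k \<phi> (z + axis j (e r t)) * h $ k) * inverse (e r t))) (at z within ?U)"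
          by (rule has_derivative_mult_left)
        moreover have "(\<lambda>h. (\<Sum>k\<in>UNIV. cpartial k \<phi> (z + axis j (e r t)) * h $ k) * inverse (e r t)) = blinfun_apply (fx z t)"
          by (simp add: fun_eq_iff fx sum_distrib_right sum_distrib_left divide_inverse mult_ac)
        ultimately show ?thesis by (simp add: divide_inverse)
      qed
      show "(\<lambda>t. \<phi> (z + axis j (e r t)) / e r t) integrable_on cbox 0 1" if "z \<in> ?U" for z
        using r that by (intro integrable_continuous cslice[OF holo_fun_continuous_on[OF hol]]) auto
    qed (use r in auto)
    then have "((\<lambda>z. integral (cbox 0 1) (\<lambda>t. \<phi> (z + axis j (e r t)) / e r t)) has_derivative
       integral (cbox 0 1) (fx z0)) (at z0)"
      using r by (simp add: at_within_open[of z0 ?U])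
    then have D: "(cpartial j \<phi> has_derivative integral (cbox 0 1) (fx z0)) (at z0)"
      by (rule has_derivative_transform_within_open[of _ _ _ _ ?U]) (use cauchy[OF hol r(1)] r in auto)
    have int: "fx z0 integrable_on cbox 0 1"
      and intk: "(\<lambda>t. cpartial k \<phi> (z0 + axis j (e r t)) / e r t) integrable_on cbox 0 1" for k
    proof -
      have "continuous_on (cbox 0 1) (fx z0)"
        unfolding fx_def using r
        by (intro continuous_on_sum bounded_bilinear.continuous_on[OF bounded_bilinear_blinfun_compose]
              bounded_linear.continuous_on[OF bounded_linear_blinfun_mult_right] continuous_on_const cslice[OF contpd]) auto
      then show "fx z0 integrable_on cbox 0 1" by (rule integrable_continuous)
      show "(\<lambda>t. cpartial k \<phi> (z0 + axis j (e r t)) / e r t) integrable_on cbox 0 1"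
        using r by (intro integrable_continuous cslice[OF contpd]) auto
    qed
    have "blinfun_apply (integral (cbox 0 1) (fx z0)) h = 
       (\<Sum>k\<in>UNIV. integral (cbox 0 1) (\<lambda>t. cpartial k \<phi> (z0 + axis j (e r t)) / e r t) * h $ k)" for h
    proof -
      have "blinfun_apply (integral (cbox 0 1) (fx z0)) h = integral (cbox 0 1) (\<lambda>t. fx z0 t h)"
        using blinfun_apply_integral[OF int] by simp
      also have "\<dots> = (\<Sum>k\<in>UNIV. integral (cbox 0 1) (\<lambda>t. cpartial k \<phi> (z0 + axis j (e r t)) / e r t * h $ k))"
        unfolding fx by (rule integral_sum[OF finite]) (rule integrable_on_mult_left[OF intk])
      finally show ?thesis by (simp only: Henstock_Kurzweil_Integration.integral_mult_left)
    qed
    then have "blinfun_apply (integral (cbox 0 1) (fx z0)) = (\<lambda>h. \<Sum>k\<in>UNIV. integral (cbox 0 1) (\<lambda>t. cpartial k \<phi> (z0 + axis j (e r t)) / e r t) * h $ k)"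
      by blast
    with D show ?thesis by simp
  qed
  have holo: "holo_fun \<Omega> (cpartial j \<phi>)" for j
    unfolding holo_fun_def
  proof
    fix z0 assume z0: "z0 \<in> \<Omega>"
    with ball obtain r where "r > 0" "\<forall>z\<in>ball z0 r. cball z r \<subseteq> \<Omega>" by blast
    from key[OF z0 this, of j]
    show "\<exists>c::complex^'n. (cpartial j \<phi> has_derivative (\<lambda>h. \<Sum>j\<in>UNIV. c $ j * h $ j)) (at z0)"
      by (intro exI[of _ "\<chi> k. integral (cbox 0 1) (\<lambda>t. cpartial k \<phi> (z0 + axis j (e r t)) / e r t)"]) simp
  qed
  then show "holo_fun \<Omega> (cpartial j \<phi>)" .
  \<comment> \<open>Differentiating the Cauchy integral for the \<open>j\<close>-th derivative under the integral sign gives the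
    Cauchy integral for the \<open>j\<close>-th derivative of the \<open>k\<close>-th one.\<close>
  show "cpartial k (cpartial j \<phi>) z = cpartial j (cpartial k \<phi>) z" if z: "z \<in> \<Omega>"
  proof -
    obtain r where r: "r > 0" "\<forall>x\<in>ball z r. cball x r \<subseteq> \<Omega>" using ball z by blast
    have "cpartial k (cpartial j \<phi>) z = integral (cbox 0 1) (\<lambda>t. cpartial k \<phi> (z + axis j (e r t)) / e r t)"
      by (rule cpartial_eq[OF key[OF z r, of j]])
    also have "\<dots> = cpartial j (cpartial k \<phi>) z"
      using r by (intro cauchy[OF holo r(1), symmetric]) auto
    finally show ?thesis .
  qed
qed

section \<open>Iterated derivatives of pullbacks\<close>

lemma cpartial_const: "cpartial j (\<lambda>z. c) z = 0"
  by (rule cpartial_eq[where c = "\<lambda>_. 0"]) simp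

text \<open>Lifts a relation preserved by single derivatives to all iterated ones. For an invariant
  of one side only, the other side is a dummy that starts at \<open>undefined\<close> and is moved
  by \<open>id\<close>.\<close>

lemma foldr_funpow_rel:
  assumes "R x y" "\<And>j x y. R x y \<Longrightarrow> R (s j x) (t j y)"
  shows "R (foldr (\<lambda>j. s j ^^ \<alpha> j) js x) (foldr (\<lambda>j. t j ^^ \<alpha> j) js y)"
proof (induction js)
  case (Cons j js)
  have "R ((s j ^^ n) x) ((t j ^^ n) y)" if "R x y" for n x y
    by (induction n) (auto intro: assms(2) that)
  with Cons show ?case by simp
qed (simp add: assms(1))

text \<open>The coordinate order is the same choice as in \<open>dbar_multi\<close>, so the two
  iterations correspond factor by factor under conjugation.\<close>

definition cpartial_multi :: "('n::finite \<Rightarrow> nat) \<Rightarrow> (complex^'n \<Rightarrow> complex) \<Rightarrow> complex^'n \<Rightarrow> complex" where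
  "cpartial_multi \<alpha> \<phi> = foldr (\<lambda>j. cpartial j ^^ \<alpha> j) (SOME js. distinct js \<and> set js = UNIV) \<phi>"

lemma cpartial_multi_zero: "cpartial_multi (\<lambda>_. 0) \<phi> = \<phi>"
proof -
  have "foldr (\<lambda>j. cpartial j ^^ 0) js \<phi> = \<phi>" for js by (induction js) auto
  then show ?thesis by (simp add: cpartial_multi_def)
qed

context
  fixes \<Omega> :: "(complex^'n) set"
  assumes op: "open \<Omega>"
begin

lemma holo_fun_cpartial_foldr:
  "holo_fun \<Omega> \<phi> \<Longrightarrow> holo_fun \<Omega> (foldr (\<lambda>j. cpartial j ^^ \<alpha> j) js \<phi>)"
  by (rule foldr_funpow_rel[where R = "\<lambda>_. holo_fun \<Omega>" and s = "\<lambda>_. id" and x = undefined])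
     (auto intro: holo_fun_cpartial[OF op])

lemma cpartial_foldr_cong:
  assumes "holo_fun \<Omega> \<phi>" "\<And>z. z \<in> \<Omega> \<Longrightarrow> \<psi> z = \<phi> z" "z \<in> \<Omega>"
  shows "foldr (\<lambda>j. cpartial j ^^ \<alpha> j) js \<psi> z = foldr (\<lambda>j. cpartial j ^^ \<alpha> j) js \<phi> z"
proof -
  let ?R = "\<lambda>\<psi> \<phi>. holo_fun \<Omega> \<phi> \<and> (\<forall>z\<in>\<Omega>. \<psi> z = \<phi> z)"
  have "?R (foldr (\<lambda>j. cpartial j ^^ \<alpha> j) js \<psi>) (foldr (\<lambda>j. cpartial j ^^ \<alpha> j) js \<phi>)"
    by (rule foldr_funpow_rel[where R = ?R]) (use assms in \<open>auto simp: cpartial_cong[OF op] holo_fun_cpartial[OF op]\<close>)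
  then show ?thesis using assms(3) by blast
qed

lemma cpartial_foldr_scale:
  assumes "holo_fun \<Omega> \<phi>" "z \<in> \<Omega>"
  shows "foldr (\<lambda>j. cpartial j ^^ \<alpha> j) js (\<lambda>z. c * \<phi> z) z = c * foldr (\<lambda>j. cpartial j ^^ \<alpha> j) js \<phi> z"
proof -
  let ?R = "\<lambda>\<psi> \<phi>. holo_fun \<Omega> \<phi> \<and> (\<forall>z\<in>\<Omega>. \<psi> z = c * \<phi> z)"
  have "?R (cpartial j \<psi>) (cpartial j \<phi>)" if "?R \<psi> \<phi>" for j \<phi> \<psi>
  proof -
    have "cpartial j \<psi> z = c * cpartial j \<phi> z" if z: "z \<in> \<Omega>" for z
    proof -
      have "cpartial j \<psi> z = cpartial j (\<lambda>z. c * \<phi> z) z"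
        using \<open>?R \<psi> \<phi>\<close> z by (intro cpartial_cong[OF op] holo_fun_mult holo_fun_const) auto
      also have "\<dots> = c * cpartial j \<phi> z"
        using \<open>?R \<psi> \<phi>\<close> z cpartial_mult[OF holo_fun_const, of \<Omega> \<phi> z j c] by (simp add: cpartial_const)
      finally show ?thesis .
    qed
    then show ?thesis using that holo_fun_cpartial[OF op] by blast
  qed
  then have "?R (foldr (\<lambda>j. cpartial j ^^ \<alpha> j) js (\<lambda>z. c * \<phi> z)) (foldr (\<lambda>j. cpartial j ^^ \<alpha> j) js \<phi>)"
    using assms(1) by (intro foldr_funpow_rel[where R = ?R]) auto
  then show ?thesis using assms(2) by blast
qed

lemma dbar_eq_cnj_cpartial:
  assumes "holo_fun \<Omega> \<phi>" "\<And>w. w \<in> \<Omega> \<Longrightarrow> g w = cnj (\<phi> w)" "w \<in> \<Omega>"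
  shows "dbar j g w = cnj (cpartial j \<phi> w)"
proof -
  have "((\<lambda>w. cnj (\<phi> w)) has_derivative (\<lambda>h. cnj (\<Sum>j\<in>UNIV. cpartial j \<phi> w * h $ j))) (at w)"
    by (rule bounded_linear.has_derivative[OF bounded_linear_cnj holo_fun_has_derivative[OF assms(1,3)]])
  then have g: "(g has_derivative (\<lambda>h. cnj (\<Sum>j\<in>UNIV. cpartial j \<phi> w * h $ j))) (at w)"
    by (rule has_derivative_transform_within_open[OF _ op assms(3)]) (simp add: assms(2))
  \<comment> \<open>Covers both real directions at once: c = 1 gives the conjugate of the partial
    derivative and c = \<i> gives -\<i> times it, so the two terms of \<open>dbar\<close> agree and
    their mean is the claim.\<close>
  have v: "vector_derivative (\<lambda>t::real. g (w + axis j (c * of_real t))) (at 0) = cnj (cpartial j \<phi> w * c)" for c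
  proof (rule vector_derivative_at)
    have l: "((\<lambda>t::real. w + axis j (c * of_real t)) has_derivative (\<lambda>t. axis j (c * of_real t))) (at 0)"
      by (rule has_derivative_compose[OF _ has_derivative_axis_line, where f = "\<lambda>t. c * of_real t"])
         (auto intro!: derivative_eq_intros)
    have z: "w + axis j (c * of_real 0) = w" by (simp add: vec_eq_iff axis_def)
    have "((\<lambda>t::real. g (w + axis j (c * of_real t))) has_derivative
        (\<lambda>t. cnj (\<Sum>k\<in>UNIV. cpartial k \<phi> w * axis j (c * of_real t) $ k))) (at 0)"
      by (rule has_derivative_compose[OF l]) (simp only: z g)
    then show "((\<lambda>t::real. g (w + axis j (c * of_real t))) has_vector_derivative cnj (cpartial j \<phi> w * c)) (at 0)"
      by (simp add: has_vector_derivative_def sum_mult_axis scaleR_conv_of_real mult_ac)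
  qed
  show ?thesis
    unfolding dbar_def using v[of 1] v[of \<i>] by (simp add: algebra_simps)
qed

lemma dbar_multi_eq_cnj_cpartial_multi:
  assumes "holo_fun \<Omega> \<phi>" "\<And>w. w \<in> \<Omega> \<Longrightarrow> g w = cnj (\<phi> w)" "w \<in> \<Omega>"
  shows "dbar_multi \<alpha> g w = cnj (cpartial_multi \<alpha> \<phi> w)"
proof -
  let ?R = "\<lambda>g \<phi>. holo_fun \<Omega> \<phi> \<and> (\<forall>z\<in>\<Omega>. g z = cnj (\<phi> z))"
  have "?R (dbar_multi \<alpha> g) (cpartial_multi \<alpha> \<phi>)"
    unfolding dbar_multi_def cpartial_multi_def
    by (rule foldr_funpow_rel[where R = ?R]) (use assms in \<open>auto simp: dbar_eq_cnj_cpartial holo_fun_cpartial[OF op]\<close>)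
  then show ?thesis using assms(3) by blast
qed

lemma cpartial_funpow_commute:
  assumes "holo_fun \<Omega> \<phi>"
  shows "\<forall>z\<in>\<Omega>. cpartial k ((cpartial j ^^ n) \<phi>) z = (cpartial j ^^ n) (cpartial k \<phi>) z"
proof -
  have "holo_fun \<Omega> ((cpartial j ^^ n) \<phi>) \<and> holo_fun \<Omega> ((cpartial j ^^ n) (cpartial k \<phi>)) \<and>
    (\<forall>z\<in>\<Omega>. (cpartial j ^^ n) (cpartial k \<phi>) z = cpartial k ((cpartial j ^^ n) \<phi>) z)"
  proof (induction n)
    case 0
    then show ?case using assms holo_fun_cpartial[OF op] by simp
  next
    case (Suc n)
    then have "\<forall>z\<in>\<Omega>. cpartial j ((cpartial j ^^ n) (cpartial k \<phi>)) z = cpartial j (cpartial k ((cpartial j ^^ n) \<phi>)) z"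
      by (auto intro: cpartial_cong[OF op] holo_fun_cpartial[OF op])
    with Suc show ?case using holo_fun_cpartial[OF op] cpartial_commute[OF op] by simp
  qed
  then show ?thesis by simp
qed

text \<open>The extra derivative is commuted inward past the other blocks until it meets the block
  of k. Distinctness guarantees that there is only one such block, so raising the exponent at k
  leaves the rest of the list unaffected.\<close>

lemma cpartial_cpartial_foldr:
  assumes "holo_fun \<Omega> \<phi>" "distinct js" "k \<in> set js"
  shows "\<forall>z\<in>\<Omega>. cpartial k (foldr (\<lambda>j. cpartial j ^^ \<alpha> j) js \<phi>) z =
    foldr (\<lambda>j. cpartial j ^^ (\<alpha>(k := Suc (\<alpha> k))) j) js \<phi> z"
  using assms(2,3)
proof (induction js)
  case (Cons j js)
  let ?\<alpha> = "\<alpha>(k := Suc (\<alpha> k))"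
  show ?case
  proof (cases "k = j")
    case True
    have "foldr (\<lambda>j. cpartial j ^^ ?\<alpha> j) js \<phi> = foldr (\<lambda>j. cpartial j ^^ \<alpha> j) js \<phi>"
      by (rule foldr_cong) (use Cons.prems True in auto)
    then show ?thesis using True by simp
  next
    case False
    let ?g = "foldr (\<lambda>j. cpartial j ^^ \<alpha> j) js \<phi>"
    have hg: "holo_fun \<Omega> ?g" by (rule holo_fun_cpartial_foldr[OF assms(1)])
    have IH: "\<forall>z\<in>\<Omega>. cpartial k ?g z = foldr (\<lambda>j. cpartial j ^^ ?\<alpha> j) js \<phi> z"
      using Cons False by simp
    \<comment> \<open>The one-element list \<open>[j]\<close> with constant exponent n turns
      \<open>cpartial_foldr_cong\<close> into a congruence for powers of
      \<open>cpartial j\<close>.\<close>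
    have "(cpartial j ^^ n) (cpartial k ?g) z = (cpartial j ^^ n) (foldr (\<lambda>j. cpartial j ^^ ?\<alpha> j) js \<phi>) z" if "z \<in> \<Omega>" for z n
      using cpartial_foldr_cong[OF holo_fun_cpartial_foldr[OF assms(1)], of "cpartial k ?g" ?\<alpha> js z "\<lambda>_. n" "[j]"] IH that by simp
    then show ?thesis
      using cpartial_funpow_commute[OF hg] False by simp
  qed
qed simp

lemma holo_fun_cpartial_multi: "holo_fun \<Omega> \<phi> \<Longrightarrow> holo_fun \<Omega> (cpartial_multi \<alpha> \<phi>)"
  unfolding cpartial_multi_def by (rule holo_fun_cpartial_foldr)

lemma cpartial_cpartial_multi:
  assumes "holo_fun \<Omega> \<phi>" "z \<in> \<Omega>"
  shows "cpartial k (cpartial_multi \<alpha> \<phi>) z = cpartial_multi (\<alpha>(k := Suc (\<alpha> k))) \<phi> z"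
proof -
  have "\<exists>js. distinct js \<and> set js = (UNIV :: 'n set)"
    using finite_distinct_list[of "UNIV :: 'n set"] by auto
  from someI_ex[OF this] show ?thesis
    unfolding cpartial_multi_def using cpartial_cpartial_foldr[OF assms(1)] assms(2) by blast
qed

end

section \<open>Derivatives of weighted pullbacks as differential operators with holomorphic
  coefficients\<close>

locale holo_change =
  fixes \<Omega> V :: "(complex^'n) set" and F :: "complex^'n \<Rightarrow> complex^'n"
  assumes open_\<Omega>: "open \<Omega>" and open_V: "open V"
    and holo_F: "holo_map V F" and F_into: "F ` V \<subseteq> \<Omega>"
begin

text \<open>A differential operator along \<open>F\<close> of finite order. The essential point is
  that L is chosen before \<phi>, so the coefficients are the same for every function. A list is
  used because the chain rule may produce the same term repeatedly.\<close>

definition pullback_diffop ::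
    "((complex^'n \<Rightarrow> complex) \<Rightarrow> complex^'n \<Rightarrow> complex) \<Rightarrow> bool" where
  "pullback_diffop A \<longleftrightarrow> (\<exists>L. (\<forall>(a, \<beta>)\<in>set L. holo_fun V a) \<and>
     (\<forall>\<phi> \<eta>. holo_fun \<Omega> \<phi> \<longrightarrow> \<eta> \<in> V \<longrightarrow> A \<phi> \<eta> = (\<Sum>(a, \<beta>)\<leftarrow>L. a \<eta> * cpartial_multi \<beta> \<phi> (F \<eta>))))"

lemma pullback_diffop_cong:
  assumes "pullback_diffop A" "\<And>\<phi> \<eta>. holo_fun \<Omega> \<phi> \<Longrightarrow> \<eta> \<in> V \<Longrightarrow> B \<phi> \<eta> = A \<phi> \<eta>"
  shows "pullback_diffop B"
  using assms unfolding pullback_diffop_def by metis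

lemma pullback_diffop_zero: "pullback_diffop (\<lambda>\<phi> \<eta>. 0)"
  unfolding pullback_diffop_def by (intro exI[of _ "[]"]) simp

lemma pullback_diffop_add:
  assumes "pullback_diffop A" "pullback_diffop B"
  shows "pullback_diffop (\<lambda>\<phi> \<eta>. A \<phi> \<eta> + B \<phi> \<eta>)"
proof -
  obtain L where "\<forall>(a, \<beta>)\<in>set L. holo_fun V a"
    "\<forall>\<phi> \<eta>. holo_fun \<Omega> \<phi> \<longrightarrow> \<eta> \<in> V \<longrightarrow> A \<phi> \<eta> = (\<Sum>(a, \<beta>)\<leftarrow>L. a \<eta> * cpartial_multi \<beta> \<phi> (F \<eta>))"
    using assms(1) unfolding pullback_diffop_def by blast
  moreover obtain M where "\<forall>(a, \<beta>)\<in>set M. holo_fun V a"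
    "\<forall>\<phi> \<eta>. holo_fun \<Omega> \<phi> \<longrightarrow> \<eta> \<in> V \<longrightarrow> B \<phi> \<eta> = (\<Sum>(a, \<beta>)\<leftarrow>M. a \<eta> * cpartial_multi \<beta> \<phi> (F \<eta>))"
    using assms(2) unfolding pullback_diffop_def by blast
  ultimately show ?thesis
    unfolding pullback_diffop_def by (intro exI[of _ "L @ M"]) (simp add: ball_Un)
qed

lemma pullback_diffop_sum:
  "(\<And>i. i \<in> I \<Longrightarrow> pullback_diffop (A i)) \<Longrightarrow> pullback_diffop (\<lambda>\<phi> \<eta>. \<Sum>i\<in>I. A i \<phi> \<eta>)"
  by (induction I rule: infinite_finite_induct) (auto intro: pullback_diffop_zero pullback_diffop_add)

lemma pullback_diffop_single:
  "holo_fun V a \<Longrightarrow> pullback_diffop (\<lambda>\<phi> \<eta>. a \<eta> * cpartial_multi \<beta> \<phi> (F \<eta>))"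
  unfolding pullback_diffop_def by (intro exI[of _ "[(a, \<beta>)]"]) simp

lemma holo_fun_cpartial_multi_F:
  "holo_fun \<Omega> \<phi> \<Longrightarrow> holo_fun V (\<lambda>\<eta>. cpartial_multi \<beta> \<phi> (F \<eta>))"
  by (rule holo_fun_compose[OF holo_F holo_fun_cpartial_multi[OF open_\<Omega>] F_into])

lemma cpartial_pullback_single:
  assumes "holo_fun V a" "holo_fun \<Omega> \<phi>" "\<eta> \<in> V"
  shows "cpartial j (\<lambda>\<eta>. a \<eta> * cpartial_multi \<beta> \<phi> (F \<eta>)) \<eta> = cpartial j a \<eta> * cpartial_multi \<beta> \<phi> (F \<eta>) +
    (\<Sum>k\<in>UNIV. (a \<eta> * cpartial j (\<lambda>\<eta>. F \<eta> $ k) \<eta>) * cpartial_multi (\<beta>(k := Suc (\<beta> k))) \<phi> (F \<eta>))"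
proof -
  have "F \<eta> \<in> \<Omega>" using F_into assms(3) by blast
  then have "cpartial j (\<lambda>\<eta>. cpartial_multi \<beta> \<phi> (F \<eta>)) \<eta> =
     (\<Sum>k\<in>UNIV. cpartial_multi (\<beta>(k := Suc (\<beta> k))) \<phi> (F \<eta>) * cpartial j (\<lambda>\<eta>. F \<eta> $ k) \<eta>)"
    using cpartial_compose[OF holo_F holo_fun_cpartial_multi[OF open_\<Omega> assms(2)] F_into assms(3)]
    by (simp add: cpartial_cpartial_multi[OF open_\<Omega> assms(2)])
  then show ?thesis
    by (simp add: cpartial_mult[OF assms(1) holo_fun_cpartial_multi_F[OF assms(2)] assms(3)] sum_distrib_left mult_ac)
qed

text \<open>Each term yields one with its coefficient differentiated and, for every component of
  \<open>F\<close>, one of higher order. The new coefficients are holomorphic because partial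
  derivatives of holomorphic functions are.\<close>

lemma pullback_diffop_cpartial_list:
  assumes "\<forall>(a, \<beta>)\<in>set L. holo_fun V a"
  shows "pullback_diffop (\<lambda>\<phi>. cpartial j (\<lambda>\<eta>. \<Sum>(a, \<beta>)\<leftarrow>L. a \<eta> * cpartial_multi \<beta> \<phi> (F \<eta>)))"
  using assms
proof (induction L)
  case Nil
  then show ?case by (simp add: cpartial_const pullback_diffop_zero)
next
  case (Cons p L)
  obtain a \<beta> where p: "p = (a, \<beta>)" by (cases p)
  have a: "holo_fun V a" and L: "\<forall>(a, \<beta>)\<in>set L. holo_fun V a" using Cons.prems p by auto
  have hL: "holo_fun V (\<lambda>\<eta>. \<Sum>(a, \<beta>)\<leftarrow>L. a \<eta> * cpartial_multi \<beta> \<phi> (F \<eta>))" if "holo_fun \<Omega> \<phi>" for \<phi>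
    using L
    by (induction L) (auto intro!: holo_fun_const holo_fun_add holo_fun_mult holo_fun_cpartial_multi_F that)
  have "pullback_diffop (\<lambda>\<phi> \<eta>. (cpartial j a \<eta> * cpartial_multi \<beta> \<phi> (F \<eta>) +
    (\<Sum>k\<in>UNIV. (a \<eta> * cpartial j (\<lambda>\<eta>. F \<eta> $ k) \<eta>) * cpartial_multi (\<beta>(k := Suc (\<beta> k))) \<phi> (F \<eta>))) +
     cpartial j (\<lambda>\<eta>. \<Sum>(a, \<beta>)\<leftarrow>L. a \<eta> * cpartial_multi \<beta> \<phi> (F \<eta>)) \<eta>)"
    using holo_F unfolding holo_map_def
    by (intro pullback_diffop_add pullback_diffop_sum pullback_diffop_single Cons.IH L
          holo_fun_mult holo_fun_cpartial[OF open_V] a) blast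
  then show ?case
  proof (rule pullback_diffop_cong)
    fix \<phi> \<eta> assume \<phi>: "holo_fun \<Omega> \<phi>" and \<eta>: "\<eta> \<in> V"
    show "cpartial j (\<lambda>\<eta>. \<Sum>(a, \<beta>)\<leftarrow>p # L. a \<eta> * cpartial_multi \<beta> \<phi> (F \<eta>)) \<eta> =
      (cpartial j a \<eta> * cpartial_multi \<beta> \<phi> (F \<eta>) +
    (\<Sum>k\<in>UNIV. (a \<eta> * cpartial j (\<lambda>\<eta>. F \<eta> $ k) \<eta>) * cpartial_multi (\<beta>(k := Suc (\<beta> k))) \<phi> (F \<eta>))) +
     cpartial j (\<lambda>\<eta>. \<Sum>(a, \<beta>)\<leftarrow>L. a \<eta> * cpartial_multi \<beta> \<phi> (F \<eta>)) \<eta>"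
      using cpartial_add[OF holo_fun_mult[OF a holo_fun_cpartial_multi_F[OF \<phi>]] hL[OF \<phi>] \<eta>]
      by (simp add: p cpartial_pullback_single[OF a \<phi> \<eta>])
  qed
qed

lemma pullback_diffop_cpartial:
  assumes "pullback_diffop A"
  shows "pullback_diffop (\<lambda>\<phi>. cpartial j (A \<phi>))"
proof -
  obtain L where L: "\<forall>(a, \<beta>)\<in>set L. holo_fun V a"
    "\<forall>\<phi> \<eta>. holo_fun \<Omega> \<phi> \<longrightarrow> \<eta> \<in> V \<longrightarrow> A \<phi> \<eta> = (\<Sum>(a, \<beta>)\<leftarrow>L. a \<eta> * cpartial_multi \<beta> \<phi> (F \<eta>))"
    using assms unfolding pullback_diffop_def by blast
  show ?thesis
  proof (rule pullback_diffop_cong[OF pullback_diffop_cpartial_list[OF L(1), of j]])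
    fix \<phi> \<eta> assume \<phi>: "holo_fun \<Omega> \<phi>" and \<eta>: "\<eta> \<in> V"
    have "holo_fun V (\<lambda>\<eta>. \<Sum>(a, \<beta>)\<leftarrow>L. a \<eta> * cpartial_multi \<beta> \<phi> (F \<eta>))"
      using L(1) by (induction L) (auto intro!: holo_fun_const holo_fun_add holo_fun_mult holo_fun_cpartial_multi_F \<phi>)
    then show "cpartial j (A \<phi>) \<eta> = cpartial j (\<lambda>\<eta>. \<Sum>(a, \<beta>)\<leftarrow>L. a \<eta> * cpartial_multi \<beta> \<phi> (F \<eta>)) \<eta>"
      by (rule cpartial_cong[OF open_V]) (use L(2) \<phi> \<eta> in auto)
  qed
qed

lemma pullback_diffop_cpartial_multi:
  assumes "pullback_diffop A"
  shows "pullback_diffop (\<lambda>\<phi>. cpartial_multi \<alpha> (A \<phi>))"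
proof -
  let ?js = "SOME js. distinct js \<and> set js = (UNIV :: 'n set)"
  \<comment> \<open>Differentiation is iterated on operators instead of functions, so that the
    closure property applies; evaluation at \<phi> afterwards recovers
    \<open>cpartial_multi\<close>.\<close>
  let ?s = "\<lambda>j A \<phi>. cpartial j (A \<phi>)"
  have "pullback_diffop (foldr (\<lambda>j. ?s j ^^ \<alpha> j) ?js A)"
    by (rule foldr_funpow_rel[where R = "\<lambda>_. pullback_diffop" and s = "\<lambda>_. id" and x = undefined])
       (auto intro: assms pullback_diffop_cpartial)
  moreover have "foldr (\<lambda>j. ?s j ^^ \<alpha> j) ?js A \<phi> = cpartial_multi \<alpha> (A \<phi>)" for \<phi>
    unfolding cpartial_multi_def
    by (rule foldr_funpow_rel[where R = "\<lambda>A x. A \<phi> = x"]) auto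
  ultimately show ?thesis by (metis (no_types, lifting) pullback_diffop_cong)
qed

text \<open>With \<eta> frozen the coefficient functions become constants, and the list still serves
  all \<phi> simultaneously.\<close>

lemma cpartial_multi_pullback:
  assumes "holo_fun V a" "\<eta> \<in> V"
  obtains L where "\<And>\<phi>. holo_fun \<Omega> \<phi> \<Longrightarrow>
    cpartial_multi \<alpha> (\<lambda>\<eta>. a \<eta> * \<phi> (F \<eta>)) \<eta> = (\<Sum>(c, \<beta>)\<leftarrow>L. c * cpartial_multi \<beta> \<phi> (F \<eta>))"
proof -
  have "pullback_diffop (\<lambda>\<phi>. cpartial_multi \<alpha> (\<lambda>\<eta>. a \<eta> * \<phi> (F \<eta>)))"
    using pullback_diffop_cpartial_multi[OF pullback_diffop_single[OF assms(1), of "\<lambda>_. 0"]]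
    by (simp add: cpartial_multi_zero)
  then obtain L where L: "\<forall>\<phi> \<eta>. holo_fun \<Omega> \<phi> \<longrightarrow> \<eta> \<in> V \<longrightarrow>
    cpartial_multi \<alpha> (\<lambda>\<eta>. a \<eta> * \<phi> (F \<eta>)) \<eta> = (\<Sum>(a, \<beta>)\<leftarrow>L. a \<eta> * cpartial_multi \<beta> \<phi> (F \<eta>))"
    unfolding pullback_diffop_def by blast
  have "cpartial_multi \<alpha> (\<lambda>\<eta>. a \<eta> * \<phi> (F \<eta>)) \<eta> =
      (\<Sum>(c, \<beta>)\<leftarrow>map (\<lambda>(a, \<beta>). (a \<eta>, \<beta>)) L. c * cpartial_multi \<beta> \<phi> (F \<eta>))"
    if "holo_fun \<Omega> \<phi>" for \<phi>
    using L[rule_format, OF that assms(2)] by (simp add: o_def case_prod_unfold)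
  then show thesis by (rule that)
qed

end

section \<open>The Bergman kernel and the Bergman span\<close>

lemma bergman_span_cong:
  "g \<in> bergman_span \<Omega> \<Longrightarrow> (\<And>z. z \<in> \<Omega> \<Longrightarrow> h z = g z) \<Longrightarrow> h \<in> bergman_span \<Omega>"
  unfolding bergman_span_def by simp

lemma bergman_span_zero: "(\<lambda>z. 0) \<in> bergman_span \<Omega>"
  unfolding bergman_span_def by (auto intro!: exI[of _ "{}"])

lemma bergman_span_generator:
  assumes "w \<in> \<Omega>"
  shows "(\<lambda>z. dbar_multi \<alpha> (\<lambda>w. bergman_kernel \<Omega> z w) w) \<in> bergman_span \<Omega>"
  unfolding bergman_span_def
  by (rule CollectI, rule exI[of _ "{(\<alpha>, w)}"], rule exI[of _ "\<lambda>_ _. 1"]) (use assms in simp)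

lemma bergman_span_scale:
  assumes "g \<in> bergman_span \<Omega>"
  shows "(\<lambda>z. a * g z) \<in> bergman_span \<Omega>"
proof -
  obtain T c where T: "finite T" "\<forall>(\<alpha>, w)\<in>T. w \<in> \<Omega>"
    "\<forall>z\<in>\<Omega>. g z = (\<Sum>(\<alpha>, w)\<in>T. c \<alpha> w * dbar_multi \<alpha> (\<lambda>w. bergman_kernel \<Omega> z w) w)"
    using assms unfolding bergman_span_def by blast
  then show ?thesis
    unfolding bergman_span_def
    by (intro CollectI exI[of _ T] exI[of _ "\<lambda>\<alpha> w. a * c \<alpha> w"])
       (simp add: sum_distrib_left case_prod_unfold mult.assoc)
qed

lemma bergman_span_add:
  assumes "g \<in> bergman_span \<Omega>" "h \<in> bergman_span \<Omega>"
  shows "(\<lambda>z. g z + h z) \<in> bergman_span \<Omega>"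
proof -
  obtain T c where T: "finite T" "\<forall>(\<alpha>, w)\<in>T. w \<in> \<Omega>"
    "\<forall>z\<in>\<Omega>. g z = (\<Sum>(\<alpha>, w)\<in>T. c \<alpha> w * dbar_multi \<alpha> (\<lambda>w. bergman_kernel \<Omega> z w) w)"
    using assms(1) unfolding bergman_span_def by blast
  obtain U d where U: "finite U" "\<forall>(\<alpha>, w)\<in>U. w \<in> \<Omega>"
    "\<forall>z\<in>\<Omega>. h z = (\<Sum>(\<alpha>, w)\<in>U. d \<alpha> w * dbar_multi \<alpha> (\<lambda>w. bergman_kernel \<Omega> z w) w)"
    using assms(2) unfolding bergman_span_def by blast
  \<comment> \<open>Coefficients add on the overlap. The case distinctions are needed because c and
    d are arbitrary outside T and U.\<close>
  define e where "e \<alpha> w = (if (\<alpha>, w) \<in> T then c \<alpha> w else 0) + (if (\<alpha>, w) \<in> U then d \<alpha> w else 0)" for \<alpha> w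
  have "g z + h z = (\<Sum>(\<alpha>, w)\<in>T \<union> U. e \<alpha> w * dbar_multi \<alpha> (\<lambda>w. bergman_kernel \<Omega> z w) w)"
    if "z \<in> \<Omega>" for z
  proof -
    let ?t = "\<lambda>p. dbar_multi (fst p) (\<lambda>w. bergman_kernel \<Omega> z w) (snd p)"
    have "g z = (\<Sum>p\<in>T \<union> U. if p \<in> T then c (fst p) (snd p) * ?t p else 0)"
      using T that U(1) by (simp add: case_prod_unfold sum.If_cases Int_absorb1)
    moreover have "h z = (\<Sum>p\<in>T \<union> U. if p \<in> U then d (fst p) (snd p) * ?t p else 0)"
      using U that T(1) by (simp add: case_prod_unfold sum.If_cases Int_absorb1)
    ultimately show ?thesis
      by (simp add: case_prod_unfold e_def flip: sum.distrib) (rule sum.cong, auto simp: algebra_simps)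
  qed
  then show ?thesis
    unfolding bergman_span_def using T(1,2) U(1,2)
    by (intro CollectI exI[of _ "T \<union> U"] exI[of _ e]) auto
qed

lemma bergman_span_sum:
  "(\<And>i. i \<in> I \<Longrightarrow> g i \<in> bergman_span \<Omega>) \<Longrightarrow> (\<lambda>z. \<Sum>i\<in>I. g i z) \<in> bergman_span \<Omega>"
  by (induction I rule: infinite_finite_induct) (auto intro: bergman_span_zero bergman_span_add)

lemma bergman_span_sum_list:
  "(\<And>p. p \<in> set L \<Longrightarrow> g p \<in> bergman_span \<Omega>) \<Longrightarrow> (\<lambda>z. \<Sum>p\<leftarrow>L. g p z) \<in> bergman_span \<Omega>"
  by (induction L) (auto intro: bergman_span_zero bergman_span_add)

section \<open>Square integrability and uniqueness of the kernel\<close>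

lemma bergman_spaceD:
  assumes "h \<in> bergman_space \<Omega>"
  shows "holo_fun \<Omega> h" "set_integrable lborel \<Omega> (\<lambda>z. (norm (h z))\<^sup>2)"
  using assms by (auto simp: bergman_space_def)

lemma set_integrable_of_real_iff:
  "set_integrable M X (\<lambda>x. complex_of_real (h x)) \<longleftrightarrow> set_integrable M X h"
proof -
  have "(\<lambda>x. indicator X x *\<^sub>R complex_of_real (h x)) = (\<lambda>x. complex_of_real (indicator X x *\<^sub>R h x))"
    by (simp add: fun_eq_iff scaleR_conv_of_real)
  then show ?thesis unfolding set_integrable_def by (simp only: complex_of_real_integrable_eq)
qed

text \<open>The product of the moduli is dominated by the sum of their squares.\<close>

lemma set_integrable_mult_cnj:
  assumes op: "open \<Omega>" and g: "g \<in> bergman_space \<Omega>" and h: "h \<in> bergman_space \<Omega>"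
  shows "set_integrable lborel \<Omega> (\<lambda>w. g w * cnj (h w))"
proof (rule set_integrable_bound)
  show "set_integrable lborel \<Omega> (\<lambda>w. (norm (g w))\<^sup>2 + (norm (h w))\<^sup>2)"
    using bergman_spaceD(2)[OF g] bergman_spaceD(2)[OF h] by (rule set_integral_add)
  have "continuous_on \<Omega> (\<lambda>w. g w * cnj (h w))"
    by (intro continuous_intros holo_fun_continuous_on bergman_spaceD(1) g h)
  then show "set_borel_measurable lborel \<Omega> (\<lambda>w. g w * cnj (h w))"
    unfolding set_borel_measurable_def
    using borel_measurable_continuous_on_indicator[of \<Omega>] op by simp
  have "norm (g w * cnj (h w)) \<le> norm ((norm (g w))\<^sup>2 + (norm (h w))\<^sup>2)" for w
  proof -
    have "0 \<le> norm (g w) * norm (h w)" by simp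
    then have "norm (g w) * norm (h w) \<le> (norm (g w))\<^sup>2 + (norm (h w))\<^sup>2"
      using sum_squares_bound[of "norm (g w)" "norm (h w)"] by linarith
    then show ?thesis by (simp add: norm_mult)
  qed
  then show "AE w in lborel. w \<in> \<Omega> \<longrightarrow> norm (g w * cnj (h w)) \<le> norm ((norm (g w))\<^sup>2 + (norm (h w))\<^sup>2)"
    by simp
qed

text \<open>The set where h does not vanish is open by continuity and null because a nonnegative
  function has integral 0. A nonempty open set is not negligible.\<close>

lemma eq_zero_of_set_integral_eq_zero:
  fixes h :: "'a::euclidean_space \<Rightarrow> complex"
  assumes op: "open \<Omega>" and cont: "continuous_on \<Omega> h"
    and int: "set_integrable lborel \<Omega> (\<lambda>z. (norm (h z))\<^sup>2)"
    and zero: "(LINT z:\<Omega>|lborel. (norm (h z))\<^sup>2) = 0" and z: "z \<in> \<Omega>"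
  shows "h z = 0"
proof (rule ccontr)
  define W where "W = \<Omega> \<inter> h -` (- {0})"
  assume "h z \<noteq> 0"
  then have "z \<in> W" using z by (simp add: W_def)
  have oW: "open W" unfolding W_def
    by (rule continuous_open_preimage[OF cont op]) (simp add: open_Compl)
  have "AE z in lborel. indicator \<Omega> z *\<^sub>R (norm (h z))\<^sup>2 = 0"
    using int zero unfolding set_integrable_def set_lebesgue_integral_def
    by (subst (asm) integral_nonneg_eq_0_iff_AE) auto
  then have "AE z in lborel. z \<notin> W"
    by eventually_elim (auto simp: W_def)
  then have "W \<in> null_sets lborel" using oW by (subst AE_iff_null_sets) auto
  then have "negligible W"
    by (simp add: negligible_iff_null_sets null_sets_completionI)
  with oW \<open>z \<in> W\<close> show False using open_not_negligible by blast
qed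

text \<open>For fixed z the conjugated kernels k and k' are themselves test functions. Expanding the
  squared norm of k - k' into four integrals and applying the reproducing properties gives (k z - k
  z) - (k' z - k' z) = 0. Off the domain both kernels are normalised to 0.\<close>

lemma is_bergman_kernel_unique:
  assumes op: "open \<Omega>" and K: "is_bergman_kernel \<Omega> K" and K': "is_bergman_kernel \<Omega> K'"
  shows "K = K'"
proof (intro ext)
  fix z w
  show "K z w = K' z w"
  proof (cases "z \<in> \<Omega> \<and> w \<in> \<Omega>")
    case False
    then show ?thesis using K K' unfolding is_bergman_kernel_def by metis
  next
    case True
    then have z: "z \<in> \<Omega>" and w: "w \<in> \<Omega>" by auto
    define k where "k w = cnj (K z w)" for w
    define k' where "k' w = cnj (K' z w)" for w
    have k: "k \<in> bergman_space \<Omega>" and k': "k' \<in> bergman_space \<Omega>"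
      using K K' z unfolding is_bergman_kernel_def k_def k'_def by auto
    have rep: "(LINT w:\<Omega>|lborel. h w * cnj (k w)) = h z"
      "(LINT w:\<Omega>|lborel. h w * cnj (k' w)) = h z" if "h \<in> bergman_space \<Omega>" for h
      using K K' z that unfolding is_bergman_kernel_def k_def k'_def by auto
    note int = set_integrable_mult_cnj[OF op]
    have eq: "complex_of_real ((norm (k w - k' w))\<^sup>2) =
       (k w * cnj (k w) - k w * cnj (k' w)) - (k' w * cnj (k w) - k' w * cnj (k' w))" for w
      by (simp only: complex_norm_square complex_cnj_diff) (simp add: algebra_simps)
    have "set_integrable lborel \<Omega> (\<lambda>w. complex_of_real ((norm (k w - k' w))\<^sup>2))"
      unfolding eq by (intro set_integral_diff int k k')
    then have i: "set_integrable lborel \<Omega> (\<lambda>w. (norm (k w - k' w))\<^sup>2)"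
      by (simp only: set_integrable_of_real_iff)
    have "complex_of_real (LINT w:\<Omega>|lborel. (norm (k w - k' w))\<^sup>2) =
        (LINT w:\<Omega>|lborel. complex_of_real ((norm (k w - k' w))\<^sup>2))"
      by (rule set_integral_complex_of_real[symmetric])
    also have "\<dots> = 0"
      unfolding eq by (simp add: set_integral_diff int k k' rep)
    finally have "(LINT w:\<Omega>|lborel. (norm (k w - k' w))\<^sup>2) = 0" by simp
    moreover have "continuous_on \<Omega> (\<lambda>w. k w - k' w)"
      by (intro continuous_intros holo_fun_continuous_on bergman_spaceD(1) k k')
    ultimately have "k w - k' w = 0"
      using eq_zero_of_set_integral_eq_zero[OF op] i w by blast
    then show ?thesis by (simp add: k_def k'_def)
  qed
qed

lemma bergman_kernel_eq:
  assumes "open \<Omega>" "is_bergman_kernel \<Omega> K"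
  shows "bergman_kernel \<Omega> = K"
  unfolding bergman_kernel_def using assms is_bergman_kernel_unique
  by (metis (mono_tags, lifting) the_equality)

section \<open>Transformation of the kernel and of the span under a biholomorphism\<close>

locale biholo =
  fixes \<Omega> V :: "(complex^'n) set" and f :: "complex^'n \<Rightarrow> complex^'n"
  assumes biholo: "biholomorphism \<Omega> V f"
begin

definition F :: "complex^'n \<Rightarrow> complex^'n" where "F = inv_into \<Omega> f"
definition u :: "complex^'n \<Rightarrow> complex" where "u z = det (jac f z)"

lemma open_\<Omega>: "open \<Omega>" and open_V: "open V" and holo_f: "holo_map \<Omega> f" and holo_F: "holo_map V F"
  and inj_f: "inj_on f \<Omega>" and image_f: "f ` \<Omega> = V"
  using biholo by (auto simp: biholomorphism_def F_def bij_betw_def)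

lemma F_f [simp]: "z \<in> \<Omega> \<Longrightarrow> F (f z) = z"
  using inj_f by (simp add: F_def)

lemma f_F [simp]: "w \<in> V \<Longrightarrow> f (F w) = w"
  using image_f by (auto simp: F_def f_inv_into_f)

lemma f_in: "z \<in> \<Omega> \<Longrightarrow> f z \<in> V" and F_in: "w \<in> V \<Longrightarrow> F w \<in> \<Omega>"
  using image_f by (auto simp: F_def inv_into_into)

sublocale holo_change \<Omega> V F
  by (rule holo_change.intro[OF open_\<Omega> open_V holo_F]) (auto simp: F_in)

lemma holo_u: "holo_fun \<Omega> u"
  using holo_f unfolding u_def[abs_def] det_def jac_def holo_map_def
  by (auto intro!: holo_fun_sum holo_fun_mult holo_fun_prod holo_fun_const holo_fun_cpartial[OF open_\<Omega>])

text \<open>Differentiating \<open>F (f x) = x\<close> shows that the two Jacobian matrices are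
  inverse to each other.\<close>

lemma u_nonzero: "z \<in> \<Omega> \<Longrightarrow> u z \<noteq> 0"
proof -
  assume z: "z \<in> \<Omega>"
  have "((\<lambda>x. F (f x)) has_derivative (\<lambda>h. jac F (f z) *v (jac f z *v h))) (at z)"
    by (rule has_derivative_compose[OF holo_map_has_derivative[OF holo_f z] holo_map_has_derivative[OF holo_F f_in[OF z]]])
  then have "((\<lambda>x. x) has_derivative (\<lambda>h. jac F (f z) *v (jac f z *v h))) (at z)"
    by (rule has_derivative_transform_within_open[OF _ open_\<Omega> z]) simp
  then have "(\<lambda>h. jac F (f z) *v (jac f z *v h)) = (\<lambda>h. h)"
    by (rule has_derivative_unique) (rule has_derivative_ident)
  then have "jac F (f z) ** jac f z = mat 1"
    by (simp add: matrix_eq fun_eq_iff flip: matrix_vector_mul_assoc)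
  then have "det (jac F (f z)) * u z = 1" unfolding u_def by (metis det_I det_mul)
  then show ?thesis by auto
qed

lemma
  fixes g :: "complex^'n \<Rightarrow> complex"
  assumes "continuous_on V g"
  shows set_integrable_f: "set_integrable lborel V g \<longleftrightarrow>
      set_integrable lborel \<Omega> (\<lambda>z. (norm (u z))\<^sup>2 *\<^sub>R g (f z))"
    and set_integral_f: "(LINT w:V|lborel. g w) = (LINT z:\<Omega>|lborel. (norm (u z))\<^sup>2 *\<^sub>R g (f z))"
proof -
  have "continuous_on \<Omega> u" by (rule holo_fun_continuous_on[OF holo_u])
  then have cont: "continuous_on \<Omega> (\<lambda>z. det (jac f z))" by (simp add: u_def[abs_def])
  have "set_integrable lborel (f ` \<Omega>) g \<longleftrightarrow>
      set_integrable lborel \<Omega> (\<lambda>z. (norm (det (jac f z)))\<^sup>2 *\<^sub>R g (f z))"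
    by (rule set_integrable_change_of_variables)
       (simp_all add: image_f open_\<Omega> open_V inj_f holo_map_has_derivative[OF holo_f] cont assms)
  then show "set_integrable lborel V g \<longleftrightarrow>
      set_integrable lborel \<Omega> (\<lambda>z. (norm (u z))\<^sup>2 *\<^sub>R g (f z))"
    by (simp add: image_f u_def)
  have "(LINT w:f ` \<Omega>|lborel. g w) = (LINT z:\<Omega>|lborel. (norm (det (jac f z)))\<^sup>2 *\<^sub>R g (f z))"
    by (rule set_integral_change_of_variables)
       (simp_all add: image_f open_\<Omega> open_V inj_f holo_map_has_derivative[OF holo_f] cont assms)
  then show "(LINT w:V|lborel. g w) = (LINT z:\<Omega>|lborel. (norm (u z))\<^sup>2 *\<^sub>R g (f z))"
    by (simp add: image_f u_def)
qed

text \<open>The weight |u|^2 from the change of variables is absorbed into the square, so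
  multiplication by u after composition with f matches the square integrability conditions on the
  two domains.\<close>

lemma square_integrable_f:
  assumes "continuous_on V g"
  shows "set_integrable lborel V (\<lambda>w. (norm (g w))\<^sup>2) \<longleftrightarrow>
    set_integrable lborel \<Omega> (\<lambda>z. (norm (u z * g (f z)))\<^sup>2)"
proof -
  have "continuous_on V (\<lambda>w. complex_of_real ((norm (g w))\<^sup>2))"
    by (intro continuous_intros assms)
  from set_integrable_f[OF this]
  have "set_integrable lborel V (\<lambda>w. complex_of_real ((norm (g w))\<^sup>2)) \<longleftrightarrow>
    set_integrable lborel \<Omega> (\<lambda>z. complex_of_real ((norm (u z * g (f z)))\<^sup>2))"
    by (simp add: norm_mult power_mult_distrib scaleR_conv_of_real)
  then show ?thesis by (simp only: set_integrable_of_real_iff)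
qed

lemma holo_inverse_u_F: "holo_fun V (\<lambda>w. inverse (u (F w)))"
  by (intro holo_fun_inverse holo_fun_compose[OF holo_F holo_u] u_nonzero F_in) (auto intro: F_in)

lemma is_bergman_kernel_transform:
  assumes K: "is_bergman_kernel V K"
  shows "is_bergman_kernel \<Omega> (\<lambda>z w. if z \<in> \<Omega> \<and> w \<in> \<Omega> then u z * K (f z) (f w) * cnj (u w) else 0)"
    (is "is_bergman_kernel \<Omega> ?K")
  unfolding is_bergman_kernel_def
proof (intro conjI ballI allI impI)
  have sub: "f ` \<Omega> \<subseteq> V" using image_f by simp
  fix w assume w: "w \<in> \<Omega>"
  have "holo_fun V (\<lambda>\<zeta>. K \<zeta> (f w))" using K f_in[OF w] unfolding is_bergman_kernel_def by blast
  then have "holo_fun \<Omega> (\<lambda>z. u z * K (f z) (f w) * cnj (u w))"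
    by (intro holo_fun_mult holo_u holo_fun_const holo_fun_compose[OF holo_f _ sub])
  then show "holo_fun \<Omega> (\<lambda>z. ?K z w)"
    by (rule holo_fun_cong[OF open_\<Omega>]) (simp add: w)
next
  have sub: "f ` \<Omega> \<subseteq> V" using image_f by simp
  fix z assume z: "z \<in> \<Omega>"
  let ?\<psi> = "\<lambda>w. cnj (K (f z) w)"
  have \<psi>: "?\<psi> \<in> bergman_space V" using K f_in[OF z] unfolding is_bergman_kernel_def by blast
  note h\<psi> = bergman_spaceD(1)[OF \<psi>]
  have eq: "cnj (?K z w) = cnj (u z) * (u w * ?\<psi> (f w))" if "w \<in> \<Omega>" for w
    using that z by simp
  show "(\<lambda>w. cnj (?K z w)) \<in> bergman_space \<Omega>"
    unfolding bergman_space_def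
  proof (intro CollectI conjI)
    have "holo_fun \<Omega> (\<lambda>w. cnj (u z) * (u w * ?\<psi> (f w)))"
      by (intro holo_fun_mult holo_u holo_fun_const holo_fun_compose[OF holo_f h\<psi> sub])
    then show "holo_fun \<Omega> (\<lambda>w. cnj (?K z w))"
      by (rule holo_fun_cong[OF open_\<Omega> _ eq])
    have "set_integrable lborel \<Omega> (\<lambda>w. (norm (u w * ?\<psi> (f w)))\<^sup>2)"
      using square_integrable_f[OF holo_fun_continuous_on[OF h\<psi>]] bergman_spaceD(2)[OF \<psi>] by blast
    then have "set_integrable lborel \<Omega> (\<lambda>w. (norm (cnj (u z)))\<^sup>2 * (norm (u w * ?\<psi> (f w)))\<^sup>2)"
      by (rule set_integrable_mult_right)
    then show "set_integrable lborel \<Omega> (\<lambda>w. (norm (cnj (?K z w)))\<^sup>2)"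
      using z by (subst set_integrable_cong[OF refl refl]) (auto simp: norm_mult power_mult_distrib)
  qed
next
  fix h z assume h: "h \<in> bergman_space \<Omega>" and z: "z \<in> \<Omega>"
  \<comment> \<open>The function on V whose transform \<open>u * (H o f)\<close> is h; the
    reproducing property of K is applied to it.\<close>
  define H where "H w = inverse (u (F w)) * h (F w)" for w
  have hH: "holo_fun V H"
    unfolding H_def[abs_def]
    by (intro holo_fun_mult holo_inverse_u_F holo_fun_compose[OF holo_F bergman_spaceD(1)[OF h] F_into])
  have uH: "u w * H (f w) = h w" if "w \<in> \<Omega>" for w
    using that u_nonzero by (simp add: H_def)
  have "H \<in> bergman_space V"
    unfolding bergman_space_def
  proof (intro CollectI conjI hH)
    have "set_integrable lborel \<Omega> (\<lambda>w. (norm (u w * H (f w)))\<^sup>2)"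
      using bergman_spaceD(2)[OF h] by (subst set_integrable_cong[OF refl refl]) (auto simp: uH)
    then show "set_integrable lborel V (\<lambda>w. (norm (H w))\<^sup>2)"
      using square_integrable_f[OF holo_fun_continuous_on[OF hH]] by blast
  qed
  then have "H (f z) = (LINT w:V|lborel. H w * K (f z) w)"
    using K f_in[OF z] unfolding is_bergman_kernel_def by metis
  also have "\<dots> = (LINT w:\<Omega>|lborel. (norm (u w))\<^sup>2 *\<^sub>R (H (f w) * K (f z) (f w)))"
  proof (rule set_integral_f)
    have "(\<lambda>w. cnj (K (f z) w)) \<in> bergman_space V" using K f_in[OF z] unfolding is_bergman_kernel_def by blast
    then have "continuous_on V (\<lambda>w. cnj (cnj (K (f z) w)))"
      by (intro continuous_on_cnj holo_fun_continuous_on bergman_spaceD(1))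
    then have "continuous_on V (K (f z))" by simp
    then show "continuous_on V (\<lambda>w. H w * K (f z) w)"
      by (rule continuous_on_mult[OF holo_fun_continuous_on[OF hH]])
  qed
  finally have "h z = u z * (LINT w:\<Omega>|lborel. (norm (u w))\<^sup>2 *\<^sub>R (H (f w) * K (f z) (f w)))"
    using uH[OF z] by simp
  also have "\<dots> = (LINT w:\<Omega>|lborel. u z * ((norm (u w))\<^sup>2 *\<^sub>R (H (f w) * K (f z) (f w))))"
    by (simp only: set_integral_mult_right)
  also have "\<dots> = (LINT w:\<Omega>|lborel. h w * ?K z w)"
  proof (rule set_lebesgue_integral_cong)
    show "\<forall>w. w \<in> \<Omega> \<longrightarrow> u z * ((norm (u w))\<^sup>2 *\<^sub>R (H (f w) * K (f z) (f w))) = h w * ?K z w"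
    proof (intro allI impI)
      fix w assume w: "w \<in> \<Omega>"
      \<comment> \<open>The weight splits into \<open>u w\<close> and its conjugate: the first turns
        \<open>H (f w)\<close> back into \<open>h w\<close>, the second completes the kernel of the
        source.\<close>
      have "u z * ((norm (u w))\<^sup>2 *\<^sub>R (H (f w) * K (f z) (f w))) =
         u z * ((u w * cnj (u w)) * (H (f w) * K (f z) (f w)))"
        by (simp add: scaleR_conv_of_real flip: complex_norm_square)
      also have "\<dots> = (u w * H (f w)) * (u z * K (f z) (f w) * cnj (u w))" by simp
      finally show "u z * ((norm (u w))\<^sup>2 *\<^sub>R (H (f w) * K (f z) (f w))) = h w * ?K z w"
        using w z uH by simp
    qed
  qed (use open_\<Omega> in auto)
  finally show "(LINT w:\<Omega>|lborel. h w * ?K z w) = h z" ..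
next
  fix z w assume "z \<notin> \<Omega> \<or> w \<notin> \<Omega>"
  then show "?K z w = 0" by auto
qed

lemma generator_transform:
  assumes K: "is_bergman_kernel V K" and \<eta>: "\<eta> \<in> V"
  shows "(\<lambda>z. u z * dbar_multi \<alpha> (\<lambda>w. bergman_kernel V (f z) w) \<eta>) \<in> bergman_span \<Omega>"
proof -
  let ?U = "\<lambda>w. inverse (u (F w))"
  have K\<Omega>: "bergman_kernel \<Omega> = (\<lambda>z w. if z \<in> \<Omega> \<and> w \<in> \<Omega> then u z * K (f z) (f w) * cnj (u w) else 0)"
    and ker: "is_bergman_kernel \<Omega> (bergman_kernel \<Omega>)"
    using bergman_kernel_eq[OF open_\<Omega> is_bergman_kernel_transform[OF K]] is_bergman_kernel_transform[OF K]
    by simp_all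
  have KV: "bergman_kernel V = K" by (rule bergman_kernel_eq[OF open_V K])
  \<comment> \<open>Obtained before z is fixed, so the coefficients below do not depend on
    z.\<close>
  obtain L where L: "\<And>\<phi>. holo_fun \<Omega> \<phi> \<Longrightarrow>
    cpartial_multi \<alpha> (\<lambda>\<eta>. ?U \<eta> * \<phi> (F \<eta>)) \<eta> = (\<Sum>(c, \<beta>)\<leftarrow>L. c * cpartial_multi \<beta> \<phi> (F \<eta>))"
    using cpartial_multi_pullback[OF holo_inverse_u_F \<eta>] by blast
  have "u z * dbar_multi \<alpha> (\<lambda>w. bergman_kernel V (f z) w) \<eta> =
     (\<Sum>p\<leftarrow>L. cnj (fst p) * dbar_multi (snd p) (\<lambda>w. bergman_kernel \<Omega> z w) (F \<eta>))" if z: "z \<in> \<Omega>" for z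
  proof -
    let ?\<phi> = "\<lambda>w. cnj (bergman_kernel \<Omega> z w)"
    have \<phi>: "holo_fun \<Omega> ?\<phi>"
      using ker z bergman_spaceD(1) unfolding is_bergman_kernel_def by blast
    have hU: "holo_fun V (\<lambda>\<eta>. ?U \<eta> * ?\<phi> (F \<eta>))"
      by (intro holo_fun_mult holo_inverse_u_F holo_fun_compose[OF holo_F \<phi> F_into])
    \<comment> \<open>The transformation law solved for the kernel of V and written as the conjugate
      of a weighted pullback along \<open>F\<close>. The factor depending on z is constant in w,
      passes through the derivatives and is finally cancelled by \<open>u z\<close>.\<close>
    have KVeq: "bergman_kernel V (f z) w = cnj (inverse (cnj (u z)) * (?U w * ?\<phi> (F w)))" if "w \<in> V" for w
      using u_nonzero[OF z] u_nonzero[OF F_in[OF that]]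
      by (simp add: KV K\<Omega> z that F_in field_simps)
    have "dbar_multi \<alpha> (\<lambda>w. bergman_kernel V (f z) w) \<eta> =
       cnj (cpartial_multi \<alpha> (\<lambda>w. inverse (cnj (u z)) * (?U w * ?\<phi> (F w))) \<eta>)"
      by (rule dbar_multi_eq_cnj_cpartial_multi[OF open_V _ KVeq \<eta>])
         (rule holo_fun_mult[OF holo_fun_const hU])
    also have "\<dots> = cnj (inverse (cnj (u z)) * cpartial_multi \<alpha> (\<lambda>\<eta>. ?U \<eta> * ?\<phi> (F \<eta>)) \<eta>)"
      unfolding cpartial_multi_def by (subst cpartial_foldr_scale[OF open_V hU \<eta>]) (rule refl)
    also have "u z * \<dots> = cnj (\<Sum>(c, \<beta>)\<leftarrow>L. c * cpartial_multi \<beta> ?\<phi> (F \<eta>))"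
      using u_nonzero[OF z] L[OF \<phi>] by simp
    also have "\<dots> = (\<Sum>p\<leftarrow>L. cnj (fst p) * cnj (cpartial_multi (snd p) ?\<phi> (F \<eta>)))"
      by (induction L) (auto simp: case_prod_unfold)
    also have "\<dots> = (\<Sum>p\<leftarrow>L. cnj (fst p) * dbar_multi (snd p) (\<lambda>w. bergman_kernel \<Omega> z w) (F \<eta>))"
      using dbar_multi_eq_cnj_cpartial_multi[OF open_\<Omega> \<phi> _ F_in[OF \<eta>], of "\<lambda>w. bergman_kernel \<Omega> z w"] by simp
    finally show ?thesis .
  qed
  moreover have "(\<lambda>z. \<Sum>p\<leftarrow>L. cnj (fst p) * dbar_multi (snd p) (\<lambda>w. bergman_kernel \<Omega> z w) (F \<eta>))
      \<in> bergman_span \<Omega>"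
    by (intro bergman_span_sum_list bergman_span_scale bergman_span_generator F_in[OF \<eta>])
  ultimately show ?thesis by (simp add: bergman_span_cong)
qed

lemma bergman_span_transform:
  assumes K: "is_bergman_kernel V K" and g: "g \<in> bergman_span V"
  shows "(\<lambda>z. u z * g (f z)) \<in> bergman_span \<Omega>"
proof -
  obtain T c where T: "finite T" "\<forall>(\<alpha>, w)\<in>T. w \<in> V"
    "\<forall>z\<in>V. g z = (\<Sum>(\<alpha>, w)\<in>T. c \<alpha> w * dbar_multi \<alpha> (\<lambda>w. bergman_kernel V z w) w)"
    using g unfolding bergman_span_def by blast
  have "(\<lambda>z. \<Sum>p\<in>T. c (fst p) (snd p) * (u z * dbar_multi (fst p) (\<lambda>w. bergman_kernel V (f z) w) (snd p)))
     \<in> bergman_span \<Omega>"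
    using T(2) by (intro bergman_span_sum bergman_span_scale generator_transform[OF K]) auto
  then show ?thesis
    by (rule bergman_span_cong)
       (simp add: T(3) f_in sum_distrib_left case_prod_unfold mult_ac)
qed

end

text \<open>Without a kernel, \<open>bergman_kernel V\<close> is 0 by its default branch. All
  generators then vanish, and the constant 1 cannot be a combination of them on a nonempty
  set.\<close>

lemma is_bergman_kernel_exists:
  assumes "V \<noteq> {}" "(\<lambda>z. 1) \<in> bergman_span V"
  obtains K where "is_bergman_kernel V K"
proof (rule ccontr)
  assume "\<not> thesis"
  with that have "bergman_kernel V = (\<lambda>z w. 0)"
    unfolding bergman_kernel_def by auto
  moreover have "dbar j (\<lambda>w. 0) = (\<lambda>w. 0)" for j :: 'a
    by (simp add: dbar_def fun_eq_iff)
  then have "dbar_multi \<alpha> (\<lambda>w. 0 :: complex) = (\<lambda>w. 0)" for \<alpha> :: "'a \<Rightarrow> nat"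
    unfolding dbar_multi_def
    by (intro foldr_funpow_rel[where R = "\<lambda>x y. x = (\<lambda>w. 0)" and t = "\<lambda>_. id" and y = undefined]) auto
  ultimately show False
    using assms unfolding bergman_span_def by auto
qed

section \<open>The components of the map as quotients of span elements\<close>

theorem proposition3p4:
  fixes \<Omega> V :: "(complex^'n) set" and f :: "complex^'n \<Rightarrow> complex^'n"
  assumes "is_domain \<Omega>" and "emeasure lborel \<Omega> < \<infinity>"
    and "is_domain V" and "emeasure lborel V < \<infinity>"
    and "biholomorphism \<Omega> V f"
    and "QDP V"
  shows "bergman_coordinate \<Omega> f"
proof -
  interpret biholo \<Omega> V f by (rule biholo.intro[OF assms(5)])
  have one: "(\<lambda>z. 1) \<in> bergman_span V" and poly: "\<And>p. holo_polynomial p \<Longrightarrow> p \<in> bergman_span V"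
    using assms(6) by (auto simp: QDP_def quadrature_domain_def)
  obtain K where K: "is_bergman_kernel V K"
    using is_bergman_kernel_exists[OF _ one] assms(3) unfolding is_domain_def by blast
  have den: "u \<in> bergman_span \<Omega>"
    using bergman_span_transform[OF K one] by simp
  have num: "(\<lambda>z. u z * f z $ j) \<in> bergman_span \<Omega>" for j
  proof -
    have "holo_polynomial (\<lambda>z::complex^'n. z $ j)"
      unfolding holo_polynomial_def
    \<comment> \<open>The j-th coordinate is the single monomial whose exponent is 1 at j and 0
      elsewhere, with coefficient 1.\<close>
    proof (intro exI[of _ "{\<lambda>i. if i = j then 1 else 0}"] exI[of _ "\<lambda>_. 1"] conjI allI)
      fix z :: "complex^'n"
      have "(\<Prod>i\<in>UNIV. z $ i ^ (if i = j then 1 else 0)) = (\<Prod>i\<in>UNIV. if i = j then z $ i else 1)"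
        by (rule prod.cong) auto
      then show "z $ j = (\<Sum>\<alpha>\<in>{\<lambda>i. if i = j then 1 else 0}. 1 * (\<Prod>i\<in>UNIV. z $ i ^ \<alpha> i))"
        by simp
    qed simp
    from bergman_span_transform[OF K poly[OF this]] show ?thesis .
  qed
  have "\<exists>z\<in>\<Omega>. u z \<noteq> 0" using assms(1) u_nonzero by (auto simp: is_domain_def)
  then have "\<exists>g\<in>bergman_span \<Omega>. \<exists>h\<in>bergman_span \<Omega>.
        (\<exists>z\<in>\<Omega>. h z \<noteq> 0) \<and> (\<forall>z\<in>\<Omega>. h z \<noteq> 0 \<longrightarrow> f z $ j = g z / h z)" for j
    by (intro bexI[OF _ num[of j]] bexI[OF _ den]) simp
  then show ?thesis
    using biholo image_f by (simp add: bergman_coordinate_def)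
qed

end
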